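(* For every integer $N$ with $5\le N\le 23$, there exists a tight $N$-point simplex in $\mathbb{O}\mathbb{P}^2$.
   Context: $\mathbb{O}\mathbb{P}^2$ is the set of $3\times3$ octonionic Hermitian matrices $\Pi$ with $\Pi^2=\Pi$ and $\operatorname{Tr}\Pi=1$, with inner product $\langle A,B\rangle=\operatorname{Re}\operatorname{Tr}(AB)$. A tight simplex of $N$ points in $\mathbb{O}\mathbb{P}^2$ is a set of $N$ distinct points $\Pi_1,\dots,\Pi_N$ with $\langle\Pi_i,\Pi_j\rangle=\frac{N-3}{3(N-1)}$ for all $i\ne j$. *)

theory Defs
  imports "HOL-Analysis.Analysis"
begin

text \<open>Quaternions as pairs of complex numbers, octonions as pairs of quaternions.
  Cayley--Dickson: (a,b)(c,d) = (ac - d^* b, d a + b c^*), (a,b)^* = (a^*, -b).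
  Addition is componentwise (product-type instance).\<close>

type_synonym quat = "complex \<times> complex"
type_synonym oct = "quat \<times> quat"

definition qconj :: "quat \<Rightarrow> quat" where
  "qconj x = (cnj (fst x), - snd x)"

definition qmul :: "quat \<Rightarrow> quat \<Rightarrow> quat" where
  "qmul x y = (fst x * fst y - cnj (snd y) * snd x,
               snd y * fst x + snd x * cnj (fst y))"

definition oconj :: "oct \<Rightarrow> oct" where
  "oconj x = (qconj (fst x), - snd x)"

definition omul :: "oct \<Rightarrow> oct \<Rightarrow> oct" where
  "omul x y = (qmul (fst x) (fst y) - qmul (qconj (snd y)) (snd x),
               qmul (snd y) (fst x) + qmul (snd x) (qconj (fst y)))"

definition oRe :: "oct \<Rightarrow> real" where
  "oRe x = Re (fst (fst x))"

definition oone :: oct where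
  "oone = ((1, 0), (0, 0))"

type_synonym omat = "3 \<Rightarrow> 3 \<Rightarrow> oct"

definition omat_mul :: "omat \<Rightarrow> omat \<Rightarrow> omat" where
  "omat_mul A B = (\<lambda>i j. \<Sum>k\<in>UNIV. omul (A i k) (B k j))"

definition otrace :: "omat \<Rightarrow> oct" where
  "otrace A = (\<Sum>i\<in>UNIV. A i i)"

definition ohermitian :: "omat \<Rightarrow> bool" where
  "ohermitian A \<longleftrightarrow> (\<forall>i j. A j i = oconj (A i j))"

definition oinner :: "omat \<Rightarrow> omat \<Rightarrow> real" where
  "oinner A B = oRe (otrace (omat_mul A B))"

definition OP2 :: "omat set" where
  "OP2 = {P. ohermitian P \<and> omat_mul P P = P \<and> otrace P = oone}"

definition tight_simplex :: "nat \<Rightarrow> (nat \<Rightarrow> omat) \<Rightarrow> bool" where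
  "tight_simplex N P \<longleftrightarrow>
     (\<forall>i<N. P i \<in> OP2) \<and> inj_on P {..<N} \<and>
     (\<forall>i<N. \<forall>j<N. i \<noteq> j \<longrightarrow>
        oinner (P i) (P j) = (real N - 3) / (3 * (real N - 1)))"

end

theory Submission
  imports Defs "HOL-Library.More_List"
begin

text \<open>
  A maximal torus of the automorphism group of \<open>OP2\<close> acts diagonally on the twelve complex coordinates of
  the off-diagonal entries of an octonionic Hermitian matrix, and it fixes the diagonal.  Take the
  orbit of a point under a cyclic subgroup of order \<open>n\<close>.  By finite Fourier analysis all inner products
  in the orbit agree if, for each nonzero residue \<open>r\<close> modulo \<open>n\<close>, the coordinates of weight \<open>\<plusminus>r\<close> carry
  the same total squared norm; two orbits are at constant distance if the corresponding Hermitian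
  products vanish.  A tight simplex with \<open>N \<le> 21\<close> points is found as a single orbit (for \<open>N = 6\<close>:
  a coordinate idempotent and an orbit of length 5), one with 22 points as a coordinate idempotent and
  an orbit of length 21, and one with 23 points as a coordinate idempotent and two orbits of length 11.

  The conditions form a system of polynomial equations with integer coefficients.  For \<open>N \<ge> 8\<close>
  a solution exists near a numerical one: affine arithmetic over the integers shows that a Newton-like
  map sends a small cube into itself, and Brouwer's theorem yields a zero.
\<close>

section \<open>Octonions and rank-one projections\<close>

lemma omul_oconj_components:
  "omul ((a, b), (c, d)) (oconj ((a', b'), (c', d'))) =
    ((a * cnj a' + b * cnj b' + c * cnj c' + cnj d * d',
      b * a' - a * b' + d * cnj c' - cnj c * d'),
     (c * a' - a * c' + cnj b * d' - d * cnj b',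
      d * cnj a' - cnj a * d' + c * b' - b * c'))"
  by (simp add: omul_def oconj_def qmul_def qconj_def algebra_simps)

text \<open>Turns real inner products into polynomials in complex coordinates and their conjugates,
  so that identities between them follow by ring normalisation.\<close>

lemma of_real_inner_complex: "complex_of_real (a \<bullet> b) = (a * cnj b + cnj a * b) / 2"
  by (simp add: complex_eq_iff inner_complex_def)

lemma of_real_oct_norm:
  "complex_of_real (((a, b), (c, d)) \<bullet> ((a, b), (c, d))) =
     a * cnj a + b * cnj b + c * cnj c + d * cnj d"
  by (simp add: inner_prod_def of_real_inner_complex algebra_simps)

lemma omul_scaleR_left: "omul (r *\<^sub>R a) b = r *\<^sub>R omul a b"
  by (simp add: omul_def qmul_def qconj_def prod_eq_iff algebra_simps)

lemma omul_scaleR_right: "omul a (r *\<^sub>R b) = r *\<^sub>R omul a b"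
  by (simp add: omul_def qmul_def qconj_def prod_eq_iff algebra_simps)

lemma oconj_scaleR: "oconj (r *\<^sub>R a) = r *\<^sub>R oconj a"
  by (simp add: oconj_def qconj_def prod_eq_iff)

lemma omul_oone: "omul oone a = a" "omul a oone = a" 
  by (simp_all add: omul_def qmul_def qconj_def oone_def prod_eq_iff)

lemma oconj_oone: "oconj oone = oone"
  by (simp add: oconj_def qconj_def oone_def prod_eq_iff)

lemma oconj_omul: "oconj (omul a b) = omul (oconj b) (oconj a)"
  by (simp add: omul_def qmul_def oconj_def qconj_def prod_eq_iff algebra_simps)

lemma oconj_oconj: "oconj (oconj a) = a"
  by (simp add: oconj_def qconj_def prod_eq_iff)

lemma omul_self_oconj: "omul a (oconj a) = (a \<bullet> a) *\<^sub>R oone"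
proof -
  obtain p q r s where a: "a = ((p, q), (r, s))" by (metis prod.exhaust)
  show ?thesis unfolding a omul_oconj_components
    by (simp add: oone_def scaleR_conv_of_real of_real_oct_norm algebra_simps del: inner_Pair)
qed

text \<open>An alternative law. It replaces associativity in the proof that the projections are
  idempotent.\<close>

lemma omul_oconj_cancel_right: "omul (omul a (oconj b)) b = (b \<bullet> b) *\<^sub>R a"
proof -
  obtain p q r s where b: "b = ((p, q), (r, s))" by (metis prod.exhaust)
  obtain p' q' r' s' where a: "a = ((p', q'), (r', s'))" by (metis prod.exhaust)
  show ?thesis unfolding a b omul_oconj_components
    by (simp add: omul_def qmul_def qconj_def scaleR_conv_of_real of_real_oct_norm algebra_simps del: inner_Pair)
qed

lemma inner_oconj: "oconj a \<bullet> oconj b = a \<bullet> b"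
  by (simp add: oconj_def qconj_def inner_prod_def inner_complex_def)

lemma omul_oconj_self: "omul (oconj a) a = (a \<bullet> a) *\<^sub>R oone"
  using omul_self_oconj[of "oconj a"] by (simp add: oconj_oconj inner_oconj)

lemma omul_oconj_cancel_left: "omul (oconj b) (omul b a) = (b \<bullet> b) *\<^sub>R a"
  using arg_cong[OF omul_oconj_cancel_right[of "oconj a" b], of oconj]
  by (simp add: oconj_omul oconj_oconj oconj_scaleR)

lemma inner_omul_adjoint: "omul a (oconj b) \<bullet> c = a \<bullet> omul c b"
proof -
  obtain p q r s where b: "b = ((p, q), (r, s))" by (metis prod.exhaust)
  obtain p' q' r' s' where a: "a = ((p', q'), (r', s'))" by (metis prod.exhaust)
  obtain p'' q'' r'' s'' where c: "c = ((p'', q''), (r'', s''))" by (metis prod.exhaust)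
  have "complex_of_real (omul a (oconj b) \<bullet> c) = complex_of_real (a \<bullet> omul c b)"
    unfolding a b c omul_oconj_components
    by (simp add: omul_def qmul_def qconj_def of_real_inner_complex field_simps)
  then show ?thesis by (simp only: of_real_eq_iff)
qed

text \<open>Multiplicativity of the norm: the second factor moves across the inner product by the
  adjoint rule and then cancels.\<close>

lemma inner_omul_oconj: "omul a (oconj b) \<bullet> omul a (oconj b) = (a \<bullet> a) * (b \<bullet> b)"
  by (simp add: inner_omul_adjoint omul_oconj_cancel_right)

lemma oRe_omul_oconj: "oRe (omul a (oconj b)) = a \<bullet> b"
proof -
  obtain p q r s where b: "b = ((p, q), (r, s))" by (metis prod.exhaust)
  obtain p' q' r' s' where a: "a = ((p', q'), (r', s'))" by (metis prod.exhaust)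
  show ?thesis unfolding a b omul_oconj_components
    by (simp add: oRe_def inner_complex_def)
qed

lemma omul_oconj_mult_swap:
  "omul (omul a (oconj b)) (omul b (oconj a)) = ((a \<bullet> a) * (b \<bullet> b)) *\<^sub>R oone"
  using omul_self_oconj[of "omul a (oconj b)"]
  by (simp add: oconj_omul oconj_oconj inner_omul_oconj)

section \<open>The trace form and projections onto vectors with real first entry\<close>

lemma oinner_hermitian:
  assumes "ohermitian B"
  shows "oinner A B = (\<Sum>i\<in>UNIV. \<Sum>j\<in>UNIV. A i j \<bullet> B i j)"
proof -
  have B: "oconj (B i j) = B j i" for i j
    using assms by (metis ohermitian_def)
  have "oinner A B = (\<Sum>i\<in>UNIV. \<Sum>j\<in>UNIV. oRe (omul (A i j) (B j i)))"
    by (simp add: oinner_def otrace_def omat_mul_def oRe_def fst_sum)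
  also have "\<dots> = (\<Sum>i\<in>UNIV. \<Sum>j\<in>UNIV. oRe (omul (A i j) (oconj (B i j))))"
    by (simp add: B)
  finally show ?thesis by (simp add: oRe_omul_oconj)
qed

definition ovec :: "real \<Rightarrow> oct \<Rightarrow> oct \<Rightarrow> 3 \<Rightarrow> oct" where
  "ovec x y z i = (if i = 1 then x *\<^sub>R oone else if i = 2 then y else z)"

text \<open>The matrix \<open>v * v^*\<close> divided by \<open>s\<close>, where \<open>s\<close> is
  meant to be the squared norm of \<open>v\<close>.\<close>

definition oproj :: "real \<Rightarrow> real \<Rightarrow> oct \<Rightarrow> oct \<Rightarrow> omat" where
  "oproj s x y z = (\<lambda>i j. (1 / s) *\<^sub>R omul (ovec x y z i) (oconj (ovec x y z j)))"

lemma inner_oone: "oone \<bullet> oone = 1"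
  by (simp add: oone_def)

lemma ohermitian_oproj: "ohermitian (oproj s x y z)"
  by (simp add: ohermitian_def oproj_def oconj_scaleR oconj_omul oconj_oconj)

lemma ovec_simps: "ovec x y z 1 = x *\<^sub>R oone" "ovec x y z 2 = y" "ovec x y z 3 = z"
  by (simp_all add: ovec_def)

lemmas oproj_simps = ovec_simps oconj_scaleR oconj_oone omul_scaleR_left
  omul_scaleR_right omul_oone omul_self_oconj omul_oconj_self omul_oconj_mult_swap omul_oconj_cancel_left
  omul_oconj_cancel_right

text \<open>At most two of the three entries are not real, so this is an instance of Artin's
  theorem: subalgebras with two generators are associative.\<close>

lemma omul_ovec:
  "omul (omul (ovec x y z i) (oconj (ovec x y z k))) (omul (ovec x y z k) (oconj (ovec x y z j))) =
     (ovec x y z k \<bullet> ovec x y z k) *\<^sub>R omul (ovec x y z i) (oconj (ovec x y z j))"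
  using exhaust_3[of i] exhaust_3[of j] exhaust_3[of k]
  by (elim disjE) (simp_all add: oproj_simps inner_oone mult_ac)

lemma oproj_in_OP2:
  assumes s: "x\<^sup>2 + y \<bullet> y + z \<bullet> z = s" and "0 < s"
  shows "oproj s x y z \<in> OP2"
proof -
  define v where "v = ovec x y z"
  have v: "(\<Sum>k\<in>UNIV. v k \<bullet> v k) = s"
    using s by (simp add: v_def sum_3 ovec_simps inner_oone power2_eq_square)
  have "omat_mul (oproj s x y z) (oproj s x y z) i j = oproj s x y z i j" for i j
  proof -
    have "omat_mul (oproj s x y z) (oproj s x y z) i j =
        (\<Sum>k\<in>UNIV. (v k \<bullet> v k / s\<^sup>2) *\<^sub>R omul (v i) (oconj (v j)))"
      by (simp add: omat_mul_def oproj_def omul_scaleR_left omul_scaleR_right omul_ovec v_def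
          power2_eq_square)
    also have "\<dots> = (s / s\<^sup>2) *\<^sub>R omul (v i) (oconj (v j))"
      by (simp only: v scaleR_sum_left[symmetric] sum_divide_distrib[symmetric])
    finally show ?thesis using \<open>0 < s\<close> by (simp add: oproj_def v_def power2_eq_square)
  qed
  moreover have "otrace (oproj s x y z) = oone"
  proof -
    have "otrace (oproj s x y z) = (\<Sum>k\<in>UNIV. (v k \<bullet> v k / s) *\<^sub>R oone)"
      by (simp add: otrace_def oproj_def omul_self_oconj v_def)
    also have "\<dots> = oone"
      using \<open>0 < s\<close> unfolding scaleR_sum_left[symmetric] sum_divide_distrib[symmetric] v by simp
    finally show ?thesis .
  qed
  ultimately show ?thesis
    using ohermitian_oproj unfolding OP2_def by blast
qed

lemma oinner_oproj:
  "oinner (oproj s x y z) (oproj s x' y' z') =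
     (x\<^sup>2 * x'\<^sup>2 + (y \<bullet> y) * (y' \<bullet> y') + (z \<bullet> z) * (z' \<bullet> z') +
      2 * (x * x' * (y \<bullet> y' + z \<bullet> z') + omul y (oconj z) \<bullet> omul y' (oconj z'))) / s\<^sup>2"
proof -
  \<comment> \<open>The entries in positions (3,2) and (2,3) are conjugate, and conjugation
    preserves inner products.\<close>
  have *: "omul z (oconj y) \<bullet> omul z' (oconj y') = omul y (oconj z) \<bullet> omul y' (oconj z')"
    using inner_oconj[of "omul y (oconj z)" "omul y' (oconj z')"]
    by (simp add: oconj_omul oconj_oconj)
  have "oinner (oproj s x y z) (oproj s x' y' z') =
      (\<Sum>i\<in>UNIV. \<Sum>j\<in>UNIV. omul (ovec x y z i) (oconj (ovec x y z j)) \<bullet>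
        omul (ovec x' y' z' i) (oconj (ovec x' y' z' j))) / s\<^sup>2"
    unfolding oinner_hermitian[OF ohermitian_oproj]
    by (simp add: oproj_def power2_eq_square sum_divide_distrib)
  also have "(\<Sum>i\<in>UNIV. \<Sum>j\<in>UNIV. omul (ovec x y z i) (oconj (ovec x y z j)) \<bullet>
        omul (ovec x' y' z' i) (oconj (ovec x' y' z' j))) =
      x\<^sup>2 * x'\<^sup>2 + (y \<bullet> y) * (y' \<bullet> y') + (z \<bullet> z) * (z' \<bullet> z') +
      2 * (x * x' * (y \<bullet> y' + z \<bullet> z') + omul y (oconj z) \<bullet> omul y' (oconj z'))"
    by (simp add: sum_3 oproj_simps inner_oconj inner_oone * power2_eq_square algebra_simps)
  finally show ?thesis .
qed

section \<open>Finite Fourier analysis\<close>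

text \<open>A character of the cyclic group of order \<open>n\<close>: \<open>k\<close> is the group
  element, \<open>j\<close> the weight of a coordinate.\<close>

definition chi :: "nat \<Rightarrow> int \<Rightarrow> int \<Rightarrow> complex" where
  "chi n k j = cis (2 * pi * k * j / n)"

lemma chi_add: "chi n k (i + j) = chi n k i * chi n k j"
  by (simp add: chi_def cis_mult ring_distribs add_divide_distrib)

lemma chi_diff: "chi n (k - k') j = cnj (chi n k' j) * chi n k j"
  by (simp add: chi_def cis_mult cis_cnj ring_distribs diff_divide_distrib)

lemma chi_0 [simp]: "chi n k 0 = 1" "chi n 0 j = 1"
  by (simp_all add: chi_def)

lemma cnj_chi: "cnj (chi n k j) = inverse (chi n k j)"
  by (simp add: chi_def cis_cnj)

lemma chi_neq_0 [simp]: "chi n k j \<noteq> 0"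
  by (simp add: chi_def)

lemma chi_uminus: "chi n k (- j) = cnj (chi n k j)"
  by (simp add: chi_def cis_cnj)

lemma chi_mod: "n > 0 \<Longrightarrow> chi n k (j mod int n) = chi n k j"
proof -
  assume n: "n > 0"
  have "chi n k (int n * q) = 1" for q
  proof -
    have "2 * pi * k * real_of_int (int n * q) / n = 2 * pi * of_int (k * q)"
      using n by simp
    then show ?thesis by (simp only: chi_def cis_multiple_2pi Ints_of_int)
  qed
  then show ?thesis
    by (metis chi_add div_mult_mod_eq mult.commute mult_1)
qed

lemma sum_chi_eq_0:
  assumes n: "n > 0" and k: "\<not> int n dvd k"
  shows "(\<Sum>r=0..<int n. chi n k r) = 0"
proof -
  define x where "x = cis (2 * pi * k / n)"
  have pow: "chi n k (int r) = x ^ r" for r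
    by (simp add: chi_def x_def Complex.DeMoivre mult_ac)
  have "x \<noteq> 1"
  proof
    assume "x = 1"
    then have "cos (2 * pi * k / n) = 1" by (simp add: x_def complex_eq_iff)
    then obtain q :: int where "2 * pi * k / n = q * 2 * pi" by (auto simp: cos_one_2pi_int)
    then have "real_of_int k = real_of_int (q * int n)" using n by (simp add: field_simps)
    then have "k = q * int n" by (simp only: of_int_eq_iff)
    then show False using k by simp
  qed
  moreover have "x ^ n = 1" using chi_mod[OF n, of k "int n"] by (simp add: pow[symmetric])
  moreover have "(\<Sum>r=0..<int n. chi n k r) = (\<Sum>r<n. x ^ r)"
    by (rule sum.reindex_bij_witness[of _ int nat]) (auto simp: pow[symmetric])
  ultimately show ?thesis by (simp add: geometric_sum)
qed

text \<open>The Fourier coefficient at \<open>r\<close> of the function sending \<open>k\<close> to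
  the sum of \<open>2 * Re (c l * chi n k (w l))\<close>. As \<open>2 * Re u = u + cnj u\<close>,
  each coordinate enters at its weight and, conjugated, at the opposite weight.\<close>

definition resid_sum :: "nat set \<Rightarrow> nat \<Rightarrow> (nat \<Rightarrow> int) \<Rightarrow> (nat \<Rightarrow> complex) \<Rightarrow> int \<Rightarrow> complex" where
  "resid_sum A n w c r =
     (\<Sum>l\<in>A. of_bool (w l mod int n = r) * c l + of_bool (- w l mod int n = r) * cnj (c l))"

text \<open>Conjugate symmetry of the Fourier coefficients of a real function; it reduces all
  conditions to residues up to \<open>n div 2\<close>.\<close>

lemma resid_sum_uminus:
  assumes "n > 0"
  shows "resid_sum A n w c (- r mod int n) = cnj (resid_sum A n w c (r mod int n))"
proof -
  have "x mod int n = - r mod int n \<longleftrightarrow> - x mod int n = r mod int n" for x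
    by (metis mod_minus_cong add.inverse_inverse)
  then show ?thesis by (auto simp: resid_sum_def intro!: sum.cong)
qed

lemma sum_chi_resid:
  assumes n: "n > 0" and A: "finite A"
  shows "(\<Sum>l\<in>A. 2 * Re (c l * chi n k (w l))) = Re (\<Sum>r=0..<int n. resid_sum A n w c r * chi n k r)"
proof -
  have pick: "(\<Sum>r=0..<int n. of_bool (j mod int n = r) * (u * chi n k r)) = u * chi n k j" for j u
  proof -
    have "(\<Sum>r=0..<int n. of_bool (j mod int n = r) * (u * chi n k r)) =
        (\<Sum>r=0..<int n. if r = j mod int n then u * chi n k r else 0)"
      by (intro sum.cong) auto
    also have "\<dots> = u * chi n k (j mod int n)" using n by simp
    finally show ?thesis using chi_mod[OF n] by simp
  qed
  have "(\<Sum>r=0..<int n. resid_sum A n w c r * chi n k r) =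
      (\<Sum>l\<in>A. \<Sum>r=0..<int n. of_bool (w l mod int n = r) * (c l * chi n k r) +
         of_bool (- w l mod int n = r) * (cnj (c l) * chi n k r))"
    unfolding resid_sum_def sum_distrib_right by (subst sum.swap) (simp add: algebra_simps)
  also have "\<dots> = (\<Sum>l\<in>A. c l * chi n k (w l) + cnj (c l * chi n k (w l)))"
    by (simp add: sum.distrib pick chi_uminus)
  also have "Re \<dots> = (\<Sum>l\<in>A. 2 * Re (c l * chi n k (w l)))"
    by (simp add: Re_sum)
  finally show ?thesis ..
qed

lemma resid_sum_total:
  assumes "n > 0" "finite A"
  shows "(\<Sum>l\<in>A. 2 * Re (c l)) = Re (\<Sum>r=0..<int n. resid_sum A n w c r)"
  using sum_chi_resid[OF assms, of c 0 w] by simp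

lemma resid_sum_0:
  assumes "\<And>l. l \<in> A \<Longrightarrow> w l mod int n = 0 \<Longrightarrow> c l = 0"
  shows "resid_sum A n w c 0 = 0"
proof -
  have "- w l mod int n = 0 \<longleftrightarrow> w l mod int n = 0" for l
    by (metis add.inverse_inverse mod_minus_cong mod_0 neg_equal_0_iff_equal)
  then show ?thesis using assms by (auto simp: resid_sum_def intro!: sum.neutral)
qed

text \<open>All Fourier coefficients vanish: at 0 because coordinates of weight 0 do not contribute,
  above \<open>n div 2\<close> by conjugate symmetry.\<close>

lemma sum_chi_cross:
  assumes n: "n > 0" and A: "finite A"
    and w: "\<And>l. l \<in> A \<Longrightarrow> w l mod int n = 0 \<Longrightarrow> c l = 0"
    and eq: "\<And>r. 1 \<le> r \<Longrightarrow> r \<le> int n div 2 \<Longrightarrow> resid_sum A n w c r = 0"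
  shows "(\<Sum>l\<in>A. 2 * Re (c l * chi n k (w l))) = 0"
proof -
  have "resid_sum A n w c r = 0" if "r \<in> {0..<int n}" for r
  proof -
    have "r = 0 \<or> 1 \<le> r \<and> r \<le> int n div 2 \<or> 1 \<le> int n - r \<and> int n - r \<le> int n div 2"
      using that unfolding atLeastLessThan_iff by arith
    then consider "r = 0" | "1 \<le> r" "r \<le> int n div 2" | "1 \<le> int n - r" "int n - r \<le> int n div 2"
      by blast
    then show ?thesis
    proof cases
      case 3
      then show ?thesis
        using resid_sum_uminus[OF n, of A w c r] eq[of "int n - r"] that n
        by (auto simp: zmod_zminus1_eq_if split: if_splits)
    qed (use resid_sum_0[OF w] eq in auto)
  qed
  then show ?thesis unfolding sum_chi_resid[OF n A] by simp
qed

text \<open>All Fourier coefficients at nonzero residues equal \<open>K\<close>, so the sum is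
  \<open>K\<close> times a vanishing complete character sum, minus the term at residue 0. The
  coefficient at 1 is recovered from \<open>total\<close>, the value at
  \<open>k = 0\<close>.\<close>

lemma sum_chi_self:
  assumes n: "n \<ge> 3" and A: "finite A" and k: "\<not> int n dvd k"
    and real: "\<And>l. l \<in> A \<Longrightarrow> c l \<in> \<real>"
    and w: "\<And>l. l \<in> A \<Longrightarrow> w l mod int n = 0 \<Longrightarrow> c l = 0"
    and eq: "\<And>r. 2 \<le> r \<Longrightarrow> r \<le> int n div 2 \<Longrightarrow> Re (resid_sum A n w c r) = K"
    and total: "(\<Sum>l\<in>A. 2 * Re (c l)) = (real n - 1) * K"
  shows "(\<Sum>l\<in>A. 2 * Re (c l * chi n k (w l))) = - K"
proof -
  have n0: "n > 0" using n by simp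
  define T where "T = resid_sum A n w c"
  have cnj_T: "cnj (T r) = T r" for r
    using real by (auto simp: T_def resid_sum_def Reals_cnj_iff intro!: sum.cong)
  have T_real: "T r = complex_of_real (Re (T r))" for r
    using cnj_T[of r] by (simp add: complex_eq_iff)
  have T_uminus: "T (int n - r) = T r" if "0 < r" "r < int n" for r
    using resid_sum_uminus[OF n0, of A w c r] that cnj_T by (simp add: T_def mod_pos_pos_trivial zmod_zminus1_eq_if)
  have mid: "Re (T r) = K" if "2 \<le> r" "r \<le> int n - 2" for r
  proof (cases "r \<le> int n div 2")
    case True
    then show ?thesis using eq that by (simp add: T_def)
  next
    case False
    then have "Re (T (int n - r)) = K" using eq that by (simp add: T_def)
    then show ?thesis using T_uminus[of r] that by simp
  qed
  \<comment> \<open>The residues 1 and \<open>n - 1\<close> are split off because \<open>mid\<close>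
    does not cover them.\<close>
  have set: "{0..<int n} = insert 0 (insert 1 (insert (int n - 1) {2..int n - 2}))"
    using n by auto
  have T0: "T 0 = 0" using resid_sum_0[OF w] by (simp add: T_def)
  have "(real n - 1) * K = (\<Sum>r=0..<int n. Re (T r))"
    using total resid_sum_total[OF n0 A, of c w] by (simp add: T_def)
  also have "\<dots> = Re (T 1) + (Re (T (int n - 1)) + (\<Sum>r=2..int n - 2. K))"
    unfolding set using n mid T0 by simp
  also have "\<dots> = 2 * Re (T 1) + (real n - 3) * K"
    using T_uminus[of 1] n by (simp add: of_nat_diff)
  finally have "Re (T 1) = K" by (simp add: algebra_simps)
  then have T: "T r = complex_of_real K" if "r \<in> {0..<int n} - {0}" for r
  proof -
    have "r = 1 \<or> r = int n - 1 \<or> 2 \<le> r \<and> r \<le> int n - 2" using that by auto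
    then have "Re (T r) = K" using \<open>Re (T 1) = K\<close> T_uminus[of 1] mid n by auto
    then show ?thesis using T_real[of r] by simp
  qed
  have "(\<Sum>r=0..<int n. T r * chi n k r) = (\<Sum>r=0..<int n. K * chi n k r) - K"
    using n T T0 by (simp add: sum.remove[of "{0..<int n}" 0])
  also have "\<dots> = - K" using sum_chi_eq_0[OF n0 k] by (simp flip: sum_distrib_left)
  finally have "Re (\<Sum>r=0..<int n. T r * chi n k r) = - K" by simp
  then show ?thesis by (simp only: sum_chi_resid[OF n0 A] T_def)
qed

section \<open>Orbits of torus elements\<close>

definition ocoords :: "oct \<Rightarrow> complex list" where
  "ocoords x = [fst (fst x), snd (fst x), fst (snd x), snd (snd x)]"

definition pcoords :: "oct \<Rightarrow> oct \<Rightarrow> complex list" where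
  "pcoords y z = ocoords y @ ocoords z @ ocoords (omul y (oconj z))"

text \<open>The exponents with which a four-dimensional torus acts on the coordinates of \<open>y\<close>, \<open>z\<close> and
  \<open>omul y (oconj z)\<close>: the weights of \<open>y\<close> and \<open>z\<close> are chosen such that each coordinate of the product
  is homogeneous.\<close>

definition weights :: "int \<Rightarrow> int \<Rightarrow> int \<Rightarrow> int \<Rightarrow> int list" where
  "weights a b c d =
    [a + d, b + d, c + d, a + b + c + d,
     a, b, c, a + b + c + 2 * d,
     d, a + b + d, a + c + d, b + c + d]"

definition orot :: "(nat \<Rightarrow> complex) \<Rightarrow> oct \<Rightarrow> oct" where
  "orot u x = ((u 0 * fst (fst x), u 1 * snd (fst x)), (u 2 * fst (snd x), u 3 * snd (snd x)))"

text \<open>\<open>P\<close> is the square of the real first entry of the vector; that entry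
  multiplies the eight coordinates of \<open>y\<close> and \<open>z\<close> but not those of their
  product.\<close>

definition cscale :: "real \<Rightarrow> nat \<Rightarrow> real" where
  "cscale P l = (if l < 8 then P else 1)"

lemma less_12_cases:
  "(l :: nat) < 12 \<Longrightarrow> l = 0 \<or> l = 1 \<or> l = 2 \<or> l = 3 \<or> l = 4 \<or> l = 5 \<or> l = 6 \<or> l = 7 \<or> l = 8 \<or>
     l = 9 \<or> l = 10 \<or> l = 11"
  by arith

lemma sum_lessThan_12:
  "(\<Sum>l<12. f (l :: nat)) = f 0 + f 1 + f 2 + f 3 + f 4 + f 5 + f 6 + f 7 + f 8 + f 9 + f 10 + (f 11 :: 'a :: comm_monoid_add)"
  by (simp add: eval_nat_numeral add.assoc)

text \<open>Conjugation inverts characters, so every monomial in a coordinate of the product is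
  multiplied by the character of a signed sum of two weights. These sums agree over the four
  monomials; in the first coordinate, for instance, all are \<open>d\<close>.\<close>

lemma pcoords_orot:
  fixes a b c d :: int
  defines "w \<equiv> weights a b c d"
  assumes "l < 12"
  shows "pcoords (orot (\<lambda>i. chi n k (w ! i)) y) (orot (\<lambda>i. chi n k (w ! (4 + i))) z) ! l =
    chi n k (w ! l) * pcoords y z ! l"
proof -
  obtain p q r s where y: "y = ((p, q), (r, s))" by (metis prod.exhaust)
  obtain p' q' r' s' where z: "z = ((p', q'), (r', s'))" by (metis prod.exhaust)
  have double: "chi n k (2 * d) = chi n k d * chi n k d"
    by (simp only: mult_2 chi_add)
  then have double': "chi n k (d * 2) = chi n k d * chi n k d"
    by (simp add: mult.commute)
  show ?thesis
    using less_12_cases[OF \<open>l < 12\<close>]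
    by (elim disjE) (simp_all add: w_def weights_def pcoords_def ocoords_def orot_def y z
        omul_oconj_components chi_add double double' cnj_chi field_simps)
qed

text \<open>The off-diagonal part of \<open>oinner_oproj\<close>, up to the factor 2, in the
  coordinates on which the torus is diagonal.\<close>

lemma sum_pcoords:
  assumes "0 \<le> P"
  shows "sqrt P * sqrt P * (y \<bullet> y' + z \<bullet> z') + omul y (oconj z) \<bullet> omul y' (oconj z') =
    (\<Sum>l<12. cscale P l * Re (cnj (pcoords y z ! l) * pcoords y' z' ! l))"
  using assms
  by (simp add: sum_lessThan_12 cscale_def pcoords_def ocoords_def inner_prod_def inner_complex_def algebra_simps)

lemma inner_orot:
  assumes "\<And>i. cnj (u i) * u i = 1"
  shows "orot u y \<bullet> orot u y = y \<bullet> y"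
proof -
  have "(u i * a) \<bullet> (u i * a) = a \<bullet> a" for i a
  proof -
    have "complex_of_real ((u i * a) \<bullet> (u i * a)) = (cnj (u i) * u i) * complex_of_real (a \<bullet> a)"
      by (simp add: of_real_inner_complex algebra_simps)
    then show ?thesis using assms by (simp only: mult_1 of_real_eq_iff)
  qed
  then show ?thesis by (simp add: orot_def inner_prod_def)
qed

text \<open>There are \<open>m\<close> orbits of length \<open>n\<close> and, if
  \<open>f = 1\<close>, a coordinate idempotent. Multiplied by \<open>s\<^sup>2\<close>, an inner
  product of orbit points is a diagonal constant plus a character sum:
  \<open>\<alpha> * s\<^sup>2 + K\<close> and \<open>- K\<close> within an orbit,
  \<open>\<alpha> * s\<^sup>2\<close> and 0 between orbits. The value of \<open>K\<close> is forced:
  for the trivial rotation the character sum is \<open>(n - 1) * K\<close> and the total is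
  \<open>s\<^sup>2\<close>.\<close>

lemma tight_simplex_orbits:
  fixes y z :: "nat \<Rightarrow> oct" and m n f N :: nat and s P K :: real and a b c d :: int
  defines "w \<equiv> weights a b c d"
  defines "\<alpha> \<equiv> (real N - 3) / (3 * (real N - 1))"
  defines "q \<equiv> \<lambda>i j l. cscale P l * (cnj (pcoords (y i) (z i) ! l) * pcoords (y j) (z j) ! l)"
  assumes N: "N = m * n + f" "f \<le> 1" and n: "n \<ge> 3" and m: "m \<ge> 1" and s: "0 < s" and P: "0 \<le> P"
    and K: "n * K = (1 - \<alpha>) * s\<^sup>2"
    and fixed: "f = 1 \<Longrightarrow> P = \<alpha> * s"
    and norm: "\<And>i. i < m \<Longrightarrow> P + y i \<bullet> y i + z i \<bullet> z i = s"
    and diag: "\<And>i j. i < m \<Longrightarrow> j < m \<Longrightarrow>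
       P\<^sup>2 + (y i \<bullet> y i) * (y j \<bullet> y j) + (z i \<bullet> z i) * (z j \<bullet> z j) = \<alpha> * s\<^sup>2 + of_bool (i = j) * K"
    and zero: "\<And>i l. i < m \<Longrightarrow> l < 12 \<Longrightarrow> w ! l mod int n = 0 \<Longrightarrow> pcoords (y i) (z i) ! l = 0"
    and self: "\<And>i r. i < m \<Longrightarrow> 2 \<le> r \<Longrightarrow> r \<le> int n div 2 \<Longrightarrow>
       Re (resid_sum {..<12} n ((!) w) (q i i) r) = K"
    and cross: "\<And>i j r. i < m \<Longrightarrow> j < m \<Longrightarrow> i < j \<Longrightarrow> 1 \<le> r \<Longrightarrow> r \<le> int n div 2 \<Longrightarrow>
       resid_sum {..<12} n ((!) w) (q i j) r = 0"
  shows "\<exists>Q. tight_simplex N Q"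
proof -
  have n0: "n > 0" using n by simp
  have N3: "N \<ge> 3" using N n m by (metis le_add1 le_trans mult_le_mono1 mult_1)
  have \<alpha>1: "\<alpha> < 1" using N3 by (simp add: \<alpha>_def field_simps)
  define C where "C = (\<lambda>i j k. \<Sum>l<12. 2 * Re (q i j l * chi n k (w ! l)))"
  define D where "D = (\<lambda>i j. P\<^sup>2 + (y i \<bullet> y i) * (y j \<bullet> y j) + (z i \<bullet> z i) * (z j \<bullet> z j))"
  have C_self: "C i i k = - K" if i: "i < m" and k: "\<not> int n dvd k" for i k
  proof -
    have real: "q i i l \<in> \<real>" for l
      unfolding q_def by (simp add: complex_is_Real_iff)
    have "(\<Sum>l<12. 2 * Re (q i i l)) =
        2 * (\<Sum>l<12. cscale P l * Re (cnj (pcoords (y i) (z i) ! l) * pcoords (y i) (z i) ! l))"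
      unfolding sum_distrib_left by (simp add: q_def)
    also have "\<dots> = 2 * (P * (y i \<bullet> y i) + P * (z i \<bullet> z i) + (y i \<bullet> y i) * (z i \<bullet> z i))"
      unfolding sum_pcoords[OF P, symmetric] using P by (simp add: inner_omul_oconj algebra_simps)
    \<comment> \<open>By multiplicativity of the norm, the off-diagonal norms are exactly the mixed
      terms of the expanded square.\<close>
    also have "\<dots> = (P + y i \<bullet> y i + z i \<bullet> z i)\<^sup>2 - D i i"
      by (simp add: D_def power2_eq_square algebra_simps)
    also have "\<dots> = (real n - 1) * K"
      using norm[OF i] diag[OF i i] K by (simp add: D_def algebra_simps)
    finally show ?thesis
      unfolding C_def
      using real zero[OF i] self[OF i] k n
      by (intro sum_chi_self[where w = "(!) w"]) (auto simp: q_def)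
  qed
  have C_cross: "C i j k = 0" if ij: "i < j" "j < m" for i j k
    unfolding C_def
    using ij n0 zero[of i] cross[of i j]
    by (intro sum_chi_cross[where w = "(!) w"]) (auto simp: q_def)
  \<comment> \<open>Exchanging the orbits and inverting the rotation conjugates each summand, so the
    cross conditions are needed for \<open>i < j\<close> only.\<close>
  have C_commute: "C j i (- k) = C i j k" for i j k
  proof -
    have *: "q j i l * chi n (- k) (w ! l) = cnj (q i j l * chi n k (w ! l))" for l
      by (simp add: q_def chi_def cis_cnj)
    show ?thesis by (simp only: C_def * cnj.simps)
  qed
  have DC: "D i j + C i j k = \<alpha> * s\<^sup>2" if ij: "i < m" "j < m" and ne: "i \<noteq> j \<or> \<not> int n dvd k" for i j k
  proof -
    consider "i = j" "\<not> int n dvd k" | "i < j" | "j < i" using ne by linarith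
    then show ?thesis
    proof cases
      case 1
      then show ?thesis using C_self[of i k] diag[of i i] ij by (simp add: D_def)
    next
      case 2
      then show ?thesis using C_cross[of i j k] diag[of i j] ij by (simp add: D_def)
    next
      case 3
      then show ?thesis using C_cross[of j i "- k"] C_commute[of j i k] diag[of i j] ij by (simp add: D_def)
    qed
  qed
  define Y where "Y = (\<lambda>i k. orot (\<lambda>l. chi n k (w ! l)) (y i))"
  define Z where "Z = (\<lambda>i k. orot (\<lambda>l. chi n k (w ! (4 + l))) (z i))"
  have chi1: "cnj (chi n k j) * chi n k j = 1" for k j
    by (simp add: cnj_chi)
  have YY: "Y i k \<bullet> Y i k = y i \<bullet> y i" and ZZ: "Z i k \<bullet> Z i k = z i \<bullet> z i" for i k
    by (simp_all add: Y_def Z_def inner_orot chi1)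
  define pt where "pt = (\<lambda>i k. oproj s (sqrt P) (Y i k) (Z i k))"
  \<comment> \<open>The first coordinate idempotent, written with the common scale \<open>s\<close>
    so that \<open>oinner_oproj\<close> applies; its inner product with any orbit point is
    \<open>P / s\<close>.\<close>
  define pole where "pole = oproj s (sqrt s) 0 0"
  have pt_OP2: "pt i k \<in> OP2" if "i < m" for i k
    unfolding pt_def using norm[OF that] s P by (intro oproj_in_OP2) (simp_all add: YY ZZ)
  have pole_OP2: "pole \<in> OP2"
    unfolding pole_def using s by (intro oproj_in_OP2) simp_all
  have inner_pt: "oinner (pt i k) (pt j k') = \<alpha>"
    if ij: "i < m" "j < m" and ne: "i \<noteq> j \<or> \<not> int n dvd (k' - k)" for i j k k'
  proof -
    have "oinner (pt i k) (pt j k') =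
        (D i j + 2 * (\<Sum>l<12. cscale P l * Re (cnj (pcoords (Y i k) (Z i k) ! l) * pcoords (Y j k') (Z j k') ! l))) / s\<^sup>2"
      unfolding pt_def oinner_oproj sum_pcoords[OF P, symmetric] using P
      by (simp add: D_def YY ZZ power2_eq_square)
    also have "2 * (\<Sum>l<12. cscale P l * Re (cnj (pcoords (Y i k) (Z i k) ! l) * pcoords (Y j k') (Z j k') ! l)) =
        C i j (k' - k)"
      unfolding C_def sum_distrib_left
    proof (intro sum.cong refl)
      fix l :: nat assume "l \<in> {..<12}"
      then have l: "l < 12" by simp
      have "cnj (pcoords (Y i k) (Z i k) ! l) * pcoords (Y j k') (Z j k') ! l =
          cnj (pcoords (y i) (z i) ! l) * pcoords (y j) (z j) ! l * chi n (k' - k) (w ! l)"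
        unfolding Y_def Z_def w_def pcoords_orot[OF l] chi_diff by simp
      then show "2 * (cscale P l * Re (cnj (pcoords (Y i k) (Z i k) ! l) * pcoords (Y j k') (Z j k') ! l)) =
          2 * Re (q i j l * chi n (k' - k) (w ! l))"
        by (simp add: q_def mult.assoc)
    qed
    finally show ?thesis using DC[OF ij ne] s by simp
  qed
  have inner_pole: "oinner (pt i k) pole = \<alpha>" "oinner pole (pt i k) = \<alpha>" if "f = 1" for i k
    using fixed[OF that] s P
    by (simp_all add: pt_def pole_def oinner_oproj power2_eq_square omul_def qmul_def qconj_def oconj_def)
  have inner_self: "oinner A A = 1" if "A \<in> OP2" for A
    using that by (simp add: OP2_def oinner_def oRe_def oone_def)
  \<comment> \<open>The quotient by \<open>n\<close> selects the orbit, the remainder the rotation;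
    the index \<open>m * n\<close> is left for the coordinate idempotent.\<close>
  define Q where "Q = (\<lambda>i. if i < m * n then pt (i div n) (int (i mod n)) else pole)"
  have Q_OP2: "Q i \<in> OP2" for i
    using pt_OP2[of "i div n"] pole_OP2 by (simp add: Q_def less_mult_imp_div_less)
  have inner_Q: "oinner (Q i) (Q j) = \<alpha>" if ij: "i < N" "j < N" "i \<noteq> j" for i j
  proof -
    consider "i < m * n" "j < m * n" | "i < m * n" "j = m * n" "f = 1" | "i = m * n" "j < m * n" "f = 1"
      using ij N by linarith
    then show ?thesis
    proof cases
      case 1
      have "i div n \<noteq> j div n \<or> \<not> int n dvd (int (j mod n) - int (i mod n))"
      proof (rule ccontr)
        assume "\<not> ?thesis"
        then have eq: "i div n = j div n" and dvd: "int n dvd int (j mod n) - int (i mod n)" by auto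
        from dvd have "j mod n = i mod n"
          by (metis mod_eq_dvd_iff mod_mod_trivial of_nat_eq_iff zmod_int)
        then show False using eq \<open>i \<noteq> j\<close> by (metis div_mult_mod_eq)
      qed
      then show ?thesis using 1 by (simp add: Q_def inner_pt less_mult_imp_div_less)
    qed (simp_all add: Q_def inner_pole)
  qed
  \<comment> \<open>Equal points would have inner product 1, whereas
    \<open>\<alpha> < 1\<close>.\<close>
  have "inj_on Q {..<N}"
  proof (rule inj_onI, rule ccontr)
    fix i j assume ij: "i \<in> {..<N}" "j \<in> {..<N}" "Q i = Q j" "i \<noteq> j"
    then show False using inner_Q[of i j] inner_self[OF Q_OP2[of i]] \<alpha>1 by simp
  qed
  then have "tight_simplex N Q"
    using Q_OP2 inner_Q by (simp add: tight_simplex_def \<alpha>_def)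
  then show ?thesis by blast
qed

section \<open>Zeros of quadratic systems by affine arithmetic\<close>

text \<open>A form \<open>(c, g, e)\<close> encloses the numbers \<open>c + g\<^sub>0 t\<^sub>0 + g\<^sub>1 t\<^sub>1 + \<dots>\<close> up to an error \<open>e\<close>, where the
  parameters satisfy \<open>\<bar>t i\<bar> \<le> 1\<close>; a quadratic \<open>(c, ts)\<close> is the constant \<open>c\<close> plus a term
  \<open>k * x i * x j\<close> for each \<open>(k, i, j)\<close> in \<open>ts\<close>.\<close>

type_synonym aform = "int \<times> int list \<times> int"
type_synonym quadratic = "int \<times> (int \<times> nat \<times> nat) list"

fun lin :: "int list \<Rightarrow> (nat \<Rightarrow> real) \<Rightarrow> real" where
  "lin [] t = 0"
| "lin (x # xs) t = real_of_int x * t 0 + lin xs (\<lambda>i. t (Suc i))"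

fun encl :: "(nat \<Rightarrow> real) \<Rightarrow> real \<Rightarrow> aform \<Rightarrow> bool" where
  "encl t v (c, g, e) \<longleftrightarrow> \<bar>v - (c + lin g t)\<bar> \<le> e"

fun ladd :: "int list \<Rightarrow> int list \<Rightarrow> int list" where
  "ladd [] ys = ys"
| "ladd (x # xs) [] = x # xs"
| "ladd (x # xs) (y # ys) = (x + y) # ladd xs ys"

definition lnorm :: "int list \<Rightarrow> int" where
  "lnorm xs = sum_list (map abs xs)"

fun aadd :: "aform \<Rightarrow> aform \<Rightarrow> aform" where
  "aadd (c, g, e) (c', g', e') = (c + c', ladd g g', e + e')"

fun ascale :: "int \<Rightarrow> aform \<Rightarrow> aform" where
  "ascale k (c, g, e) = (k * c, map ((*) k) g, \<bar>k\<bar> * e)"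

text \<open>The product of the two non-constant parts is bounded by their norms and moved into the
  error, so the result is again affine.\<close>

fun amul :: "aform \<Rightarrow> aform \<Rightarrow> aform" where
  "amul (c, g, e) (c', g', e') =
    (c * c', ladd (map ((*) c) g') (map ((*) c') g),
     (lnorm g + e) * (lnorm g' + e') + \<bar>c\<bar> * e' + \<bar>c'\<bar> * e)"

fun rquad :: "real list \<Rightarrow> quadratic \<Rightarrow> real" where
  "rquad xs (c, ts) =
    c + (\<Sum>(k, i, j)\<leftarrow>ts. real_of_int k * nth_default 0 xs i * nth_default 0 xs j)"

fun aquad :: "aform list \<Rightarrow> quadratic \<Rightarrow> aform" where
  "aquad fs (c, ts) =
    foldr (\<lambda>(k, i, j). aadd (ascale k (amul (nth_default (0, [], 0) fs i) (nth_default (0, [], 0) fs j))))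
      ts (c, [], 0)"

text \<open>Computed values are appended and may be used like coordinates; conditions of degree four
  thus remain quadratic equations.\<close>

fun rrun :: "real list \<Rightarrow> quadratic list \<Rightarrow> real list" where
  "rrun xs [] = xs"
| "rrun xs (q # qs) = rrun (xs @ [rquad xs q]) qs"

fun arun :: "aform list \<Rightarrow> quadratic list \<Rightarrow> aform list" where
  "arun fs [] = fs"
| "arun fs (q # qs) = arun (fs @ [aquad fs q]) qs"

text \<open>As \<open>lnorm g\<close> contains \<open>g ! i\<close>, the inequality bounds the
  constant, the other coefficients and the error together by \<open>g ! i\<close>.\<close>

fun dominant :: "nat \<Rightarrow> aform \<Rightarrow> bool" where
  "dominant i (c, g, e) \<longleftrightarrow> i < length g \<and> 0 < g ! i \<and> \<bar>c\<bar> + lnorm g + e \<le> 2 * g ! i"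

fun all_dominant :: "nat \<Rightarrow> aform list \<Rightarrow> bool" where
  "all_dominant i [] \<longleftrightarrow> True"
| "all_dominant i (f # fs) \<longleftrightarrow> dominant i f \<and> all_dominant (Suc i) fs"

text \<open>Coordinates are exact affine forms in the parameters. If their coefficients come from an
  approximate inverse Jacobian, the equations are nearly diagonal in the parameters, which is what
  dominance asks for.\<close>

definition certificate :: "(int \<times> int list) list \<Rightarrow> quadratic list \<Rightarrow> quadratic list \<Rightarrow> bool" where
  "certificate xs prog eqs \<longleftrightarrow>
     all_dominant 0 (map (aquad (arun (map (\<lambda>(c, g). (c, g, 0)) xs) prog)) eqs)"

section \<open>Soundness of the enclosures\<close>

lemma lnorm_simps [simp]: "lnorm [] = 0" "lnorm (x # xs) = \<bar>x\<bar> + lnorm xs"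
  by (simp_all add: lnorm_def)

lemma lin_ladd: "lin (ladd xs ys) t = lin xs t + lin ys t"
  by (induction xs ys arbitrary: t rule: ladd.induct) (simp_all add: algebra_simps)

lemma lin_map_mult: "lin (map ((*) k) xs) t = real_of_int k * lin xs t"
  by (induction xs arbitrary: t) (simp_all add: algebra_simps)

lemma abs_lin_le:
  assumes "\<And>i. \<bar>t i\<bar> \<le> 1"
  shows "\<bar>lin xs t\<bar> \<le> lnorm xs"
  using assms
proof (induction xs arbitrary: t)
  case (Cons x xs)
  have "\<bar>real_of_int x * t 0\<bar> \<le> \<bar>real_of_int x\<bar>"
    using Cons.prems[of 0] by (simp add: abs_mult mult_left_le)
  moreover have "\<bar>lin xs (\<lambda>i. t (Suc i))\<bar> \<le> lnorm xs"
    by (rule Cons.IH) (rule Cons.prems)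
  ultimately show ?case by simp
qed simp

lemma abs_lin_minus_le:
  assumes "\<And>i. \<bar>t i\<bar> \<le> 1" "j < length xs"
  shows "\<bar>lin xs t - real_of_int (xs ! j) * t j\<bar> \<le> lnorm xs - \<bar>xs ! j\<bar>"
  using assms
proof (induction xs arbitrary: t j)
  case (Cons x xs)
  show ?case
  proof (cases j)
    case 0
    then show ?thesis using abs_lin_le[of "\<lambda>i. t (Suc i)" xs] Cons.prems by simp
  next
    case (Suc j')
    have "\<bar>real_of_int x * t 0\<bar> \<le> \<bar>real_of_int x\<bar>"
      using Cons.prems(1)[of 0] by (simp add: abs_mult mult_left_le)
    moreover have "\<bar>lin xs (\<lambda>i. t (Suc i)) - real_of_int (xs ! j') * t (Suc j')\<bar> \<le> lnorm xs - \<bar>xs ! j'\<bar>"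
      using Cons.IH[of "\<lambda>i. t (Suc i)" j'] Cons.prems Suc by simp
    ultimately show ?thesis using Suc by simp
  qed
qed simp

lemma encl_aadd: "encl t u f \<Longrightarrow> encl t v g \<Longrightarrow> encl t (u + v) (aadd f g)"
  by (cases f; cases g; simp add: lin_ladd; linarith)

lemma encl_ascale: "encl t u f \<Longrightarrow> encl t (real_of_int k * u) (ascale k f)"
proof (cases f)
  case (fields c g e)
  assume "encl t u f"
  then have "\<bar>real_of_int k\<bar> * \<bar>u - (c + lin g t)\<bar> \<le> \<bar>real_of_int k\<bar> * e"
    using fields by (intro mult_left_mono) auto
  then show ?thesis
    using fields by (simp add: lin_map_mult abs_mult[symmetric] algebra_simps)
qed

lemma encl_amul:
  assumes t: "\<And>i. \<bar>t i\<bar> \<le> 1" and f: "encl t u f" and g: "encl t v g"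
  shows "encl t (u * v) (amul f g)"
proof -
  obtain c l e where f': "f = (c, l, e)" by (cases f)
  obtain c' l' e' where g': "g = (c', l', e')" by (cases g)
  define x where "x = u - (c + lin l t)"
  define y where "y = v - (c' + lin l' t)"
  have x: "\<bar>x\<bar> \<le> e" and y: "\<bar>y\<bar> \<le> e'" using f g by (simp_all add: f' g' x_def y_def)
  have xl: "\<bar>lin l t + x\<bar> \<le> lnorm l + e" and yl: "\<bar>lin l' t + y\<bar> \<le> lnorm l' + e'"
    using abs_lin_le[of t l, OF t] abs_lin_le[of t l', OF t] x y by auto
  have "\<bar>(lin l t + x) * (lin l' t + y)\<bar> \<le> (lnorm l + e) * (lnorm l' + e')"
    unfolding abs_mult of_int_mult using xl yl by (intro mult_mono) auto
  moreover have "\<bar>c * y\<bar> \<le> \<bar>c\<bar> * e'" "\<bar>c' * x\<bar> \<le> \<bar>c'\<bar> * e"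
    using x y by (simp_all add: abs_mult mult_left_mono)
  ultimately have "\<bar>(lin l t + x) * (lin l' t + y) + c * y + c' * x\<bar>
      \<le> (lnorm l + e) * (lnorm l' + e') + \<bar>c\<bar> * e' + \<bar>c'\<bar> * e"
    by linarith
  moreover have "(lin l t + x) * (lin l' t + y) + c * y + c' * x
      = u * v - (real_of_int (c * c') + (c * lin l' t + c' * lin l t))"
    by (simp add: x_def y_def algebra_simps)
  ultimately show ?thesis by (simp add: f' g' lin_ladd lin_map_mult)
qed

text \<open>The default form encloses the default number 0, so indices need no bounds check.\<close>

lemma encl_nth_default:
  assumes "list_all2 (encl t) xs fs"
  shows "encl t (nth_default 0 xs i) (nth_default (0, [], 0) fs i)"
  using assms by (auto simp: nth_default_def list_all2_conv_all_nth)

lemma encl_quad: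
  assumes t: "\<And>i. \<bar>t i\<bar> \<le> 1" and xs: "list_all2 (encl t) xs fs"
  shows "encl t (rquad xs q) (aquad fs q)"
proof -
  obtain c ts where q: "q = (c, ts)" by (cases q)
  have "encl t (c + (\<Sum>(k, i, j)\<leftarrow>ts. real_of_int k * nth_default 0 xs i * nth_default 0 xs j))
     (foldr (\<lambda>(k, i, j). aadd (ascale k (amul (nth_default (0, [], 0) fs i) (nth_default (0, [], 0) fs j))))
      ts (c, [], 0))"
  proof (induction ts)
    case (Cons x ts)
    obtain k i j where x: "x = (k, i, j)" by (cases x)
    show ?case
      using encl_aadd[OF encl_ascale[OF encl_amul[OF t encl_nth_default[OF xs] encl_nth_default[OF xs]]] Cons.IH,
          of k i j]
      by (simp add: x algebra_simps)
  qed simp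
  then show ?thesis by (simp add: q)
qed

lemma encl_run:
  assumes t: "\<And>i. \<bar>t i\<bar> \<le> 1" and "list_all2 (encl t) xs fs"
  shows "list_all2 (encl t) (rrun xs qs) (arun fs qs)"
  using assms(2)
proof (induction qs arbitrary: xs fs)
  case (Cons q qs)
  show ?case using Cons.prems
    by (auto intro!: Cons.IH list_all2_appendI encl_quad[OF t])
qed simp

lemma all_dominant_nth: "all_dominant i fs \<Longrightarrow> j < length fs \<Longrightarrow> dominant (i + j) (fs ! j)"
  by (induction i fs arbitrary: j rule: all_dominant.induct) (auto simp: nth_Cons' less_Suc_eq_0_disj)

lemma dominant_step:
  assumes t: "\<And>i. \<bar>t i\<bar> \<le> 1" and v: "encl t v (c, g, e)" and d: "dominant i (c, g, e)"
  shows "\<bar>t i - v / real_of_int (g ! i)\<bar> \<le> 1"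
proof -
  have i: "i < length g" and gi: "0 < g ! i" and le: "\<bar>c\<bar> + lnorm g + e \<le> 2 * g ! i"
    using d by auto
  have le': "real_of_int (\<bar>c\<bar> + lnorm g + e) \<le> 2 * g ! i"
    using le by linarith
  have "\<bar>v - real_of_int (g ! i) * t i\<bar> \<le> \<bar>c\<bar> + e + (lnorm g - \<bar>g ! i\<bar>)"
    using abs_lin_minus_le[of t i g, OF t i] v by simp
  then have "\<bar>v - real_of_int (g ! i) * t i\<bar> \<le> g ! i" using le' gi by simp
  moreover have "\<bar>t i - v / real_of_int (g ! i)\<bar> = \<bar>v - real_of_int (g ! i) * t i\<bar> / g ! i"
  proof -
    have "t i - v / real_of_int (g ! i) = - (v - real_of_int (g ! i) * t i) / g ! i" using gi by (simp add: field_simps)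
    then show ?thesis using gi by (simp add: abs_divide)
  qed
  ultimately show ?thesis using gi by simp
qed

section \<open>Continuity and the fixed-point argument\<close>

lemma continuous_on_rquad:
  fixes xs :: "'a::topological_space \<Rightarrow> real list"
  assumes "\<And>i. continuous_on S (\<lambda>x. nth_default 0 (xs x) i)"
  shows "continuous_on S (\<lambda>x. rquad (xs x) q)"
proof -
  obtain c ts where q: "q = (c, ts)" by (cases q)
  have "continuous_on S (\<lambda>x. \<Sum>(k, i, j)\<leftarrow>ts. real_of_int k * nth_default 0 (xs x) i * nth_default 0 (xs x) j)"
    by (induction ts) (auto intro!: continuous_intros assms)
  then show ?thesis by (auto simp: q intro!: continuous_intros)
qed

text \<open>The common length \<open>n\<close> fixes the position at which a new value is appended,
  so each entry is a single continuous function.\<close>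

lemma continuous_on_rrun:
  fixes xs :: "'a::topological_space \<Rightarrow> real list"
  assumes "\<And>i. continuous_on S (\<lambda>x. nth_default 0 (xs x) i)" and "\<And>x. length (xs x) = n"
  shows "continuous_on S (\<lambda>x. nth_default 0 (rrun (xs x) qs) i)"
  using assms
proof (induction qs arbitrary: xs n)
  case (Cons q qs)
  have "continuous_on S (\<lambda>x. nth_default 0 (xs x @ [rquad (xs x) q]) j)" for j
  proof (cases "j < n")
    case True
    then show ?thesis using Cons.prems(1)[of j] by (simp add: nth_default_append Cons.prems(2) nth_default_nth)
  next
    case False
    then show ?thesis using continuous_on_rquad[OF Cons.prems(1), of q]
      by (cases "j - n") (simp_all add: nth_default_append Cons.prems(2))
  qed
  then show ?case by (simp, intro Cons.IH[where n = "Suc n"]) (simp_all add: Cons.prems(2))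
qed simp

lemma continuous_on_lin:
  assumes "\<And>i. continuous_on S (\<lambda>x. t x i)"
  shows "continuous_on S (\<lambda>x. lin g (t x))"
  using assms
proof (induction g arbitrary: t)
  case (Cons a g)
  then show ?case by (auto intro!: continuous_intros Cons.IH)
qed simp

text \<open>Dominance says that \<open>t i - v i / g i\<close> maps the cube into itself, where \<open>v i\<close> is the
  value of the \<open>i\<close>-th equation; a fixed point is a common zero.  The cube is padded to
  22 dimensions, the largest number of equations needed.\<close>

theorem certificate_sound:
  assumes cert: "certificate cs qs eqs" and len: "length eqs \<le> 22"
  obtains xs where "length xs = length cs" "\<And>q. q \<in> set eqs \<Longrightarrow> rquad (rrun xs qs) q = 0"
proof -
  obtain h :: "22 \<Rightarrow> nat" where h: "bij_betw h UNIV {..<22}"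
    using ex_bij_betw_finite_nat[of "UNIV :: 22 set"] by (auto simp: atLeast0LessThan)
  \<comment> \<open>A vector is read as an infinite parameter sequence, zero from index 22 on, as
    \<open>lin\<close> and \<open>encl\<close> expect.\<close>
  define t where "t = (\<lambda>(x :: real ^ 22) j. if j < 22 then x $ inv h j else 0)"
  define X where "X = (\<lambda>x. map (\<lambda>(c, g). real_of_int c + lin g (t x)) cs)"
  define v where "v = (\<lambda>x i. rquad (rrun (X x) qs) (eqs ! i))"
  define fs where "fs = map (aquad (arun (map (\<lambda>(c, g). (c, g, 0)) cs) qs)) eqs"
  define d where "d = (\<lambda>i. real_of_int (fst (snd (fs ! i)) ! i))"
  \<comment> \<open>A diagonal Newton step; axes without an equation are sent to 0, which stays
    inside the cube.\<close>
  define T where "T = (\<lambda>x. \<chi> k. if h k < length eqs then x $ k - v x (h k) / d (h k) else 0)"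
  define S where "S = {x :: real ^ 22. \<forall>k. \<bar>x $ k\<bar> \<le> 1}"
  have th: "t x (h k) = x $ k" for x k
    using h by (auto simp: t_def bij_betw_def)
  have S: "S = cbox (\<chi> k. - 1) (\<chi> k. 1)"
    by (auto simp: S_def mem_box_cart abs_le_iff minus_le_iff)
  have t1: "\<bar>t x i\<bar> \<le> 1" if "x \<in> S" for x i
    using that by (simp add: S_def t_def)
  have cont_t: "continuous_on S (\<lambda>x. t x i)" for i
    by (cases "i < 22") (auto simp: t_def intro!: continuous_intros)
  have cont_X: "continuous_on S (\<lambda>x. nth_default 0 (X x) i)" for i
    by (cases "i < length cs")
      (auto simp: X_def nth_default_def case_prod_unfold intro!: continuous_intros continuous_on_lin cont_t)
  have cont_v: "continuous_on S (\<lambda>x. v x i)" for i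
    unfolding v_def
    by (intro continuous_on_rquad continuous_on_rrun[where n = "length cs"] cont_X) (simp add: X_def)
  have encl: "encl (t x) (v x i) (fs ! i)" if "x \<in> S" "i < length eqs" for x i
  proof -
    have "list_all2 (encl (t x)) (X x) (map (\<lambda>(c, g). (c, g, 0)) cs)"
      by (auto simp: X_def list_all2_conv_all_nth split: prod.split)
    then show ?thesis
      using that t1 by (auto simp: v_def fs_def intro!: encl_quad encl_run)
  qed
  have dom: "dominant i (fs ! i)" if "i < length eqs" for i
    using all_dominant_nth[of 0 fs i] cert that by (simp add: certificate_def fs_def)
  have "continuous_on S T"
  proof -
    have "continuous_on S (\<lambda>x. if h k < length eqs then x $ k - v x (h k) / d (h k) else 0)" for k
    proof (cases "h k < length eqs")
      case True
      then have "d (h k) \<noteq> 0" using dom[of "h k"] by (cases "fs ! h k") (simp add: d_def)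
      then show ?thesis using True by (auto intro!: continuous_intros cont_v)
    qed auto
    then show ?thesis unfolding T_def by (intro continuous_on_vec_lambda)
  qed
  moreover have "T x \<in> S" if "x \<in> S" for x
  proof -
    have "\<bar>x $ k - v x (h k) / d (h k)\<bar> \<le> 1" if k: "h k < length eqs" for k
    proof -
      obtain c g e where f: "fs ! h k = (c, g, e)" by (cases "fs ! h k")
      show ?thesis
        using dominant_step[of "t x" "v x (h k)" c g e "h k", OF t1[OF \<open>x \<in> S\<close>]]
          encl[OF \<open>x \<in> S\<close> k] dom[OF k] by (simp add: f d_def th)
    qed
    then show ?thesis by (auto simp: S_def T_def)
  qed
  moreover have "compact S" "convex S" by (simp_all add: S compact_cbox)
  moreover have "0 \<in> S" by (simp add: S_def)
  ultimately obtain x where x: "x \<in> S" "T x = x"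
    using brouwer[of S T] by (metis Pi_I empty_iff)
  have "v x i = 0" if i: "i < length eqs" for i
  proof -
    have "i \<in> h ` UNIV" using i len h by (auto simp: bij_betw_def)
    then obtain k where k: "i = h k" by auto
    have "0 < d i" using dom[OF i] by (cases "fs ! i") (simp add: d_def)
    moreover have "T x $ k = x $ k" using x(2) by simp
    ultimately show ?thesis using i k by (simp add: T_def)
  qed
  then have "rquad (rrun (X x) qs) q = 0" if "q \<in> set eqs" for q
    using that by (auto simp: v_def in_set_conv_nth simp del: rquad.simps)
  moreover have "length (X x) = length cs" by (simp add: X_def)
  ultimately show thesis using that by blast
qed

section \<open>Encoding the simplex equations\<close>

text \<open>Real and imaginary parts, alternating, of the four coordinates in
  \<open>omul_oconj_components\<close>, with \<open>y\<close> stored from index \<open>i\<close> and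
  \<open>z\<close> from index \<open>i + 8\<close>.\<close>

definition product_quadratics :: "nat \<Rightarrow> quadratic list" where
  "product_quadratics i =
    [(0, [(1, i, i + 8), (1, i + 1, i + 9), (1, i + 2, i + 10), (1, i + 3, i + 11),
          (1, i + 4, i + 12), (1, i + 5, i + 13), (1, i + 6, i + 14), (1, i + 7, i + 15)]),
     (0, [(- 1, i, i + 9), (1, i + 1, i + 8), (- 1, i + 2, i + 11), (1, i + 3, i + 10),
          (- 1, i + 4, i + 13), (1, i + 5, i + 12), (1, i + 6, i + 15), (- 1, i + 7, i + 14)]),
     (0, [(- 1, i, i + 10), (1, i + 1, i + 11), (1, i + 2, i + 8), (- 1, i + 3, i + 9),
          (1, i + 6, i + 12), (1, i + 7, i + 13), (- 1, i + 4, i + 14), (- 1, i + 5, i + 15)]),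
     (0, [(- 1, i, i + 11), (- 1, i + 1, i + 10), (1, i + 2, i + 9), (1, i + 3, i + 8),
          (- 1, i + 6, i + 13), (1, i + 7, i + 12), (- 1, i + 4, i + 15), (1, i + 5, i + 14)]),
     (0, [(- 1, i, i + 12), (1, i + 1, i + 13), (1, i + 2, i + 14), (1, i + 3, i + 15),
          (1, i + 4, i + 8), (- 1, i + 5, i + 9), (- 1, i + 6, i + 10), (- 1, i + 7, i + 11)]),
     (0, [(- 1, i, i + 13), (- 1, i + 1, i + 12), (1, i + 2, i + 15), (- 1, i + 3, i + 14),
          (1, i + 4, i + 9), (1, i + 5, i + 8), (1, i + 6, i + 11), (- 1, i + 7, i + 10)]),
     (0, [(- 1, i, i + 14), (- 1, i + 1, i + 15), (- 1, i + 2, i + 12), (1, i + 3, i + 13),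
          (1, i + 4, i + 10), (- 1, i + 5, i + 11), (1, i + 6, i + 8), (1, i + 7, i + 9)]),
     (0, [(- 1, i, i + 15), (1, i + 1, i + 14), (- 1, i + 2, i + 13), (- 1, i + 3, i + 12),
          (1, i + 4, i + 11), (1, i + 5, i + 10), (- 1, i + 6, i + 9), (1, i + 7, i + 8)])]"

definition squares :: "nat \<Rightarrow> nat \<Rightarrow> (int \<times> nat \<times> nat) list" where
  "squares i k = map (\<lambda>j. (1, j, j)) [i..<i + k]"

text \<open>The real coordinates of the pairs \<open>(y, z)\<close> come first, 16 for each of the \<open>m\<close> base points,
  followed by the 8 coordinates of each product.\<close>

definition slot :: "nat \<Rightarrow> nat \<Rightarrow> nat \<Rightarrow> nat" where
  "slot m a l = (if l < 8 then 16 * a + 2 * l else 16 * m + 8 * a + 2 * (l - 8))"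

text \<open>\<open>e\<close> is 1 for real parts and \<open>- 1\<close> for imaginary parts, since
  opposite weights enter conjugated.\<close>

definition resid_coeff :: "int \<Rightarrow> int \<Rightarrow> int list \<Rightarrow> int \<Rightarrow> int \<Rightarrow> nat \<Rightarrow> int" where
  "resid_coeff n P w e r l =
    (of_bool (w ! l mod n = r) + e * of_bool (- (w ! l) mod n = r)) * (if l < 8 then P else 1)"

definition re_terms :: "int \<Rightarrow> nat \<Rightarrow> nat \<Rightarrow> (int \<times> nat \<times> nat) list" where
  "re_terms k i j = (if k = 0 then [] else [(k, i, j), (k, Suc i, Suc j)])"

definition im_terms :: "int \<Rightarrow> nat \<Rightarrow> nat \<Rightarrow> (int \<times> nat \<times> nat) list" where
  "im_terms k i j = (if k = 0 then [] else [(k, i, Suc j), (- k, Suc i, j)])"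

definition re_quad :: "nat \<Rightarrow> nat \<Rightarrow> nat \<Rightarrow> int \<Rightarrow> int \<Rightarrow> int list \<Rightarrow> int \<Rightarrow> int \<Rightarrow> quadratic" where
  "re_quad m a b n P w K r =
    (- K, concat (map (\<lambda>l. re_terms (resid_coeff n P w 1 r l) (slot m a l) (slot m b l)) [0..<12]))"

definition im_quad :: "nat \<Rightarrow> nat \<Rightarrow> nat \<Rightarrow> int \<Rightarrow> int \<Rightarrow> int list \<Rightarrow> int \<Rightarrow> quadratic" where
  "im_quad m a b n P w r =
    (0, concat (map (\<lambda>l. im_terms (resid_coeff n P w (- 1) r l) (slot m a l) (slot m b l)) [0..<12]))"

text \<open>The equation for residue 1 follows from the others by summation over all residues; including it
  would make the Jacobian singular.\<close>

definition one_orbit_eqs :: "int \<Rightarrow> int \<Rightarrow> int \<Rightarrow> int \<Rightarrow> int list \<Rightarrow> quadratic list" where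
  "one_orbit_eqs n P T K w =
    (- T, squares 0 8) # (- T, squares 8 8) # map (re_quad 1 0 0 n P w K) [2..n div 2]"

text \<open>The 32 base coordinates are followed by the two products at 32 to 47 and the squared
  norms of the two \<open>y\<close> at 48 and 49.\<close>

definition two_orbits_prog :: "quadratic list" where
  "two_orbits_prog = product_quadratics 0 @ product_quadratics 16 @ [(0, squares 0 8), (0, squares 16 8)]"

text \<open>The first three equations make the squared norms of the pairs \<open>(y, z)\<close>
  equal to \<open>(u, T - u)\<close> and \<open>(T - u, u)\<close>; the fourth says
  \<open>2 * u * (T - u) = U\<close>. For the values used below \<open>u\<close> is irrational,
  hence it is solved for instead of prescribed.\<close>

definition two_orbits_eqs :: "int \<Rightarrow> int \<Rightarrow> int \<Rightarrow> int \<Rightarrow> int \<Rightarrow> int list \<Rightarrow> quadratic list" where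
  "two_orbits_eqs n P T U K w =
    [(- T, squares 0 16), (- T, squares 16 16), (- T, squares 0 8 @ squares 16 8), (- U, [(2, 48, 49)])] @
    map (re_quad 2 0 0 n P w K) [2..n div 2] @ map (re_quad 2 1 1 n P w K) [2..n div 2] @
    concat (map (\<lambda>r. [re_quad 2 0 1 n P w 0 r, im_quad 2 0 1 n P w r]) [1..n div 2])"

section \<open>Reading real solutions as octonions\<close>

definition cpx :: "real list \<Rightarrow> nat \<Rightarrow> complex" where
  "cpx xs i = Complex (nth_default 0 xs i) (nth_default 0 xs (Suc i))"

definition octn :: "real list \<Rightarrow> nat \<Rightarrow> oct" where
  "octn xs i = ((cpx xs i, cpx xs (i + 2)), (cpx xs (i + 4), cpx xs (i + 6)))"

lemma rquad_product:
  "map (rquad xs) (product_quadratics i) =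
     concat (map (\<lambda>u. [Re u, Im u]) (ocoords (omul (octn xs i) (oconj (octn xs (i + 8))))))"
  by (simp add: product_quadratics_def octn_def omul_oconj_components ocoords_def cpx_def
      numeral_3_eq_3 algebra_simps)

lemma rquad_squares: "rquad xs (K, squares i 8) = K + octn xs i \<bullet> octn xs i"
proof -
  have "[i..<i + 8] = [i, i + 1, i + 2, i + 3, i + 4, i + 5, i + 6, i + 7]"
    by (simp add: upt_rec)
  then show ?thesis
    by (simp add: squares_def octn_def inner_prod_def inner_complex_def cpx_def eval_nat_numeral)
qed

lemma rquad_append: "rquad xs (K, ts @ us) = rquad xs (K, ts) + rquad xs (0, us)"
  by simp

lemma squares_16: "squares i 16 = squares i 8 @ squares (i + 8) 8"
proof -
  have "[i..<i + 16] = [i..<i + 8] @ [i + 8..<i + 8 + 8]"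
    using upt_add_eq_append[of i "i + 8" 8] by (simp add: add.assoc)
  then show ?thesis by (simp only: squares_def map_append)
qed

lemma rquad_re_terms:
  "(\<Sum>(k, i, j)\<leftarrow>re_terms k i j. real_of_int k * nth_default 0 xs i * nth_default 0 xs j) =
     k * Re (cnj (cpx xs i) * cpx xs j)"
  by (simp add: re_terms_def cpx_def algebra_simps)

lemma rquad_im_terms:
  "(\<Sum>(k, i, j)\<leftarrow>im_terms k i j. real_of_int k * nth_default 0 xs i * nth_default 0 xs j) =
     k * Im (cnj (cpx xs i) * cpx xs j)"
  by (simp add: im_terms_def cpx_def algebra_simps)

lemma sum_list_concat_map: "(\<Sum>x\<leftarrow>concat (map f ls). g x) = (\<Sum>l\<leftarrow>ls. \<Sum>x\<leftarrow>f l. g x)"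
  for g :: "'b \<Rightarrow> 'c :: monoid_add"
  by (induction ls) simp_all

lemma rquad_re_quad:
  "rquad xs (re_quad m a b n P w K r) =
     (\<Sum>l<12. resid_coeff n P w 1 r l * Re (cnj (cpx xs (slot m a l)) * cpx xs (slot m b l))) - K"
  by (simp add: re_quad_def sum_list_concat_map rquad_re_terms interv_sum_list_conv_sum_set_nat
      atLeast0LessThan)

lemma rquad_im_quad:
  "rquad xs (im_quad m a b n P w r) =
     (\<Sum>l<12. resid_coeff n P w (- 1) r l * Im (cnj (cpx xs (slot m a l)) * cpx xs (slot m b l)))"
  by (simp add: im_quad_def sum_list_concat_map rquad_im_terms interv_sum_list_conv_sum_set_nat
      atLeast0LessThan)

text \<open>All indices point into the initial list, so appended values do not influence later steps
  and the run is a simultaneous evaluation.\<close>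

lemma rrun_eq_map:
  assumes "\<forall>(K, ts)\<in>set qs. \<forall>(k, i, j)\<in>set ts. i < length xs \<and> j < length xs"
  shows "rrun xs qs = xs @ map (rquad xs) qs"
proof -
  have ext: "rquad (xs @ ys) q = rquad xs q" if "q \<in> set qs" for q ys
  proof -
    obtain K ts where q: "q = (K, ts)" by (cases q)
    have "map (\<lambda>(k, i, j). real_of_int k * nth_default 0 (xs @ ys) i * nth_default 0 (xs @ ys) j) ts =
        map (\<lambda>(k, i, j). real_of_int k * nth_default 0 xs i * nth_default 0 xs j) ts"
      using assms that q by (fastforce simp: nth_default_append nth_default_nth)
    then show ?thesis by (simp only: q rquad.simps)
  qed
  have "rrun (xs @ ys) rs = xs @ ys @ map (rquad xs) rs" if "set rs \<subseteq> set qs" for ys rs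
    using that
  proof (induction rs arbitrary: ys)
    case (Cons q rs)
    then show ?case using Cons.IH[of "ys @ [rquad xs q]"] ext[of q ys] by simp
  qed simp
  from this[of qs "[]"] show ?thesis by simp
qed

lemma resid_sum_cpx:
  assumes "\<And>l. l < 12 \<Longrightarrow> cpx xs (slot m a l) = pcoords y z ! l"
    and "\<And>l. l < 12 \<Longrightarrow> cpx xs (slot m b l) = pcoords y' z' ! l"
    and q: "q = (\<lambda>l. cscale (real_of_int P) l * (cnj (pcoords y z ! l) * pcoords y' z' ! l))"
  shows "Re (resid_sum {..<12} n ((!) w) q r) = rquad xs (re_quad m a b (int n) P w K r) + K"
    and "Im (resid_sum {..<12} n ((!) w) q r) = rquad xs (im_quad m a b (int n) P w r)"
proof -
  have cscale: "cscale (real_of_int P) l = real_of_int (if l < 8 then P else 1)" for l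
    by (simp add: cscale_def)
  have *: "Re (of_bool X) = of_bool X" "Im (of_bool X) = 0" for X by simp_all
  show "Re (resid_sum {..<12} n ((!) w) q r) = rquad xs (re_quad m a b (int n) P w K r) + K"
    unfolding rquad_re_quad resid_sum_def using assms(1,2)
    by (simp add: q cscale resid_coeff_def * algebra_simps)
  show "Im (resid_sum {..<12} n ((!) w) q r) = rquad xs (im_quad m a b (int n) P w r)"
    unfolding rquad_im_quad resid_sum_def using assms(1,2)
    by (simp add: q cscale resid_coeff_def * algebra_simps)
qed

lemma cpx_append: "cpx (xs @ ys) (length xs + i) = cpx ys i"
  by (simp add: cpx_def nth_default_append)

lemma cpx_concat_Re_Im:
  "t < length us \<Longrightarrow> cpx (concat (map (\<lambda>u. [Re u, Im u]) us) @ ys) (2 * t) = us ! t"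
proof (induction us arbitrary: t)
  case (Cons u us)
  then show ?case by (cases t) (simp_all add: cpx_def)
qed simp

lemma length_ocoords [simp]: "length (ocoords x) = 4"
  by (simp add: ocoords_def)

lemma cpx_slot:
  assumes len: "length xs = 16 * m" and a: "a < m" and l: "l < 12"
    and ws: "\<And>t. t < 4 \<Longrightarrow> cpx ws (8 * a + 2 * t) =
      ocoords (omul (octn xs (16 * a)) (oconj (octn xs (16 * a + 8)))) ! t"
  shows "cpx (xs @ ws) (slot m a l) = pcoords (octn xs (16 * a)) (octn xs (16 * a + 8)) ! l"
proof (cases "l < 8")
  case True
  have "Suc (16 * a + 2 * l) < length xs" using True a len by linarith
  then have "cpx (xs @ ws) (slot m a l) = cpx xs (16 * a + 2 * l)"
    using True by (simp add: slot_def cpx_def nth_default_append nth_default_nth)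
  moreover have "pcoords (octn xs (16 * a)) (octn xs (16 * a + 8)) ! l = cpx xs (16 * a + 2 * l)"
    using True less_12_cases[OF l] by (auto simp: pcoords_def ocoords_def octn_def add.commute)
  ultimately show ?thesis by simp
next
  case False
  then have "cpx (xs @ ws) (slot m a l) = cpx ws (8 * a + 2 * (l - 8))"
    using len cpx_append[of xs ws "8 * a + 2 * (l - 8)"] by (simp add: slot_def add.assoc)
  also have "\<dots> = pcoords (octn xs (16 * a)) (octn xs (16 * a + 8)) ! l"
    using False l by (subst ws) (auto simp: pcoords_def nth_append)
  finally show ?thesis .
qed

text \<open>With both squared norms equal to \<open>T\<close>, the diagonal conditions become
  arithmetic in \<open>P\<close>, \<open>T\<close> and \<open>K\<close>; only the residue conditions
  need the certificate beyond these norms.\<close>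

lemma tight_simplex_one_orbit:
  fixes n f :: nat and P T K a b c d :: int and \<alpha> s :: real
  defines "\<alpha> \<equiv> (real (n + f) - 3) / (3 * (real (n + f) - 1))"
  defines "s \<equiv> real_of_int (P + 2 * T)"
  assumes cert: "certificate cs (product_quadratics 0) (one_orbit_eqs (int n) P T K (weights a b c d))"
    and len: "length cs = 16"
    and n: "n \<in> {3..40}" "f \<le> 1" and pos: "0 \<le> P" "0 < P + 2 * T"
    and w: "\<forall>x\<in>set (weights a b c d). x mod int n \<noteq> 0"
    and K: "real_of_int (n * K) = (1 - \<alpha>) * s\<^sup>2"
    and fixed: "f = 1 \<longrightarrow> real_of_int P = \<alpha> * s"
    and diag: "real_of_int (P\<^sup>2 + 2 * T\<^sup>2) = \<alpha> * s\<^sup>2 + K"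
  shows "\<exists>Q. tight_simplex (n + f) Q"
proof -
  let ?w = "weights a b c d"
  \<comment> \<open>There are \<open>n div 2 + 1\<close> equations, which is at most 21 for
    \<open>n\<close> up to 40.\<close>
  have "length (one_orbit_eqs (int n) P T K ?w) \<le> 22"
    using n by (auto simp: one_orbit_eqs_def)
  then obtain xs where xs: "length xs = 16"
    and eqs: "\<And>q. q \<in> set (one_orbit_eqs (int n) P T K ?w) \<Longrightarrow> rquad (rrun xs (product_quadratics 0)) q = 0"
    using certificate_sound[OF cert] len by metis
  define E where "E = rrun xs (product_quadratics 0)"
  define y where "y = octn xs 0"
  define z where "z = octn xs 8"
  have E: "E = xs @ map (rquad xs) (product_quadratics 0)"
    unfolding E_def by (rule rrun_eq_map) (simp add: product_quadratics_def xs)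
  have octn_E: "octn E i = octn xs i" if "i \<le> 8" for i
    using that by (simp add: octn_def cpx_def E nth_default_append nth_default_nth xs)
  have slot: "cpx E (slot 1 0 l) = pcoords y z ! l" if "l < 12" for l
    using cpx_slot[of xs 1 0 l "map (rquad xs) (product_quadratics 0)"] that xs
      cpx_concat_Re_Im[of _ "ocoords (omul (octn xs 0) (oconj (octn xs 8)))" "[]"]
    by (simp add: E y_def z_def rquad_product)
  have yz: "y \<bullet> y = T" "z \<bullet> z = T"
    using eqs[of "(- T, squares 0 8)"] eqs[of "(- T, squares 8 8)"]
    unfolding E_def[symmetric] rquad_squares
    by (simp_all add: one_orbit_eqs_def octn_E y_def z_def)
  have self: "rquad E (re_quad 1 0 0 (int n) P ?w K r) = 0" if "2 \<le> r" "r \<le> int n div 2" for r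
    using eqs[of "re_quad 1 0 0 (int n) P ?w K r"] that by (simp add: one_orbit_eqs_def E_def)
  have len_w: "length ?w = 12" by (simp add: weights_def)
  show ?thesis
  proof (rule tight_simplex_orbits[where m = 1 and n = n and f = f and s = s and P = P and K = K
        and y = "\<lambda>_. y" and z = "\<lambda>_. z" and a = a and b = b and c = c and d = d])
    show "real_of_int P + y \<bullet> y + z \<bullet> z = s" for i :: nat
      by (simp add: yz s_def)
    show "(real_of_int P)\<^sup>2 + y \<bullet> y * (y \<bullet> y) + z \<bullet> z * (z \<bullet> z) =
        (real (n + f) - 3) / (3 * (real (n + f) - 1)) * s\<^sup>2 + of_bool (i = j) * real_of_int K" if "i < 1" "j < 1" for i j :: nat
      using that diag by (simp add: yz \<alpha>_def power2_eq_square)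
    show "Re (resid_sum {..<12} n ((!) ?w) (\<lambda>l. cscale P l * (cnj (pcoords y z ! l) * pcoords y z ! l)) r) = K"
      if "2 \<le> r" "r \<le> int n div 2" for i :: nat and r
      using resid_sum_cpx(1)[OF slot slot refl, where P = P and n = n and w = ?w and r = r and K = K] self[OF that] by simp
    \<comment> \<open>Vacuous, as no weight is divisible by \<open>n\<close>.\<close>
    show "pcoords y z ! l = 0" if "l < 12" "?w ! l mod int n = 0" for i l :: nat
      using that w len_w by (metis nth_mem)
    show "real_of_int P = (real (n + f) - 3) / (3 * (real (n + f) - 1)) * s" if "f = 1"
      using fixed that by (simp only: \<alpha>_def simp_thms)
    show "real n * real_of_int K = (1 - (real (n + f) - 3) / (3 * (real (n + f) - 1))) * s\<^sup>2"
      using K by (simp only: \<alpha>_def of_int_mult of_int_of_nat_eq)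
    show "0 < s" using pos by (simp add: s_def)
  qed (use n pos in auto)
qed

lemma tight_simplex_two_orbits:
  fixes n :: nat and P T U K a b c d :: int and \<alpha> s :: real
  defines "\<alpha> \<equiv> (real (2 * n + 1) - 3) / (3 * (real (2 * n + 1) - 1))"
  defines "s \<equiv> real_of_int (P + T)"
  assumes cert: "certificate cs two_orbits_prog (two_orbits_eqs (int n) P T U K (weights a b c d))"
    and len: "length cs = 32"
    and n: "n \<in> {3..11}" and pos: "0 \<le> P" "0 < P + T"
    and w: "\<forall>x\<in>set (weights a b c d). x mod int n \<noteq> 0"
    and K: "real_of_int (n * K) = (1 - \<alpha>) * s\<^sup>2"
    and fixed: "real_of_int P = \<alpha> * s"
    and diag: "real_of_int (P\<^sup>2 + U) = \<alpha> * s\<^sup>2" "T\<^sup>2 = 2 * U + K"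
  shows "\<exists>Q. tight_simplex (2 * n + 1) Q"
proof -
  let ?w = "weights a b c d" and ?eqs = "two_orbits_eqs (int n) P T U K (weights a b c d)"
  have concat2: "length (concat (map (\<lambda>r. [f r, g r]) rs)) = 2 * length rs" for f g :: "int \<Rightarrow> quadratic" and rs
    by (induction rs) simp_all
  \<comment> \<open>For \<open>n div 2 = 5\<close> the number of equations is
    \<open>4 + 2 * 4 + 2 * 5 = 22\<close>, exactly the dimension of the cube.\<close>
  have "int n div 2 \<le> 5" using n by auto
  then have "length ?eqs \<le> 22"
    using n by (auto simp: two_orbits_eqs_def concat2)
  then obtain xs where xs: "length xs = 32"
    and eqs: "\<And>q. q \<in> set ?eqs \<Longrightarrow> rquad (rrun xs two_orbits_prog) q = 0"
    using certificate_sound[OF cert] len by metis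
  define E where "E = rrun xs two_orbits_prog"
  define y where "y = (\<lambda>i. octn xs (16 * i))"
  define z where "z = (\<lambda>i. octn xs (16 * i + 8))"
  define W where "W = (\<lambda>i. map (rquad xs) (product_quadratics i))"
  have len_W: "length (W i) = 8" for i by (simp add: W_def product_quadratics_def)
  have bounds: "\<forall>(K, ts)\<in>set two_orbits_prog. \<forall>(k, i, j)\<in>set ts. i < length xs \<and> j < length xs"
    by (auto simp: two_orbits_prog_def product_quadratics_def squares_def xs)
  have E: "E = xs @ W 0 @ W 16 @ [y 0 \<bullet> y 0, y 1 \<bullet> y 1]"
    using rrun_eq_map[OF bounds]
    by (simp add: E_def two_orbits_prog_def W_def rquad_squares y_def del: rquad.simps)
  have octn_E: "octn E i = octn xs i" if "i \<le> 24" for i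
    using that by (simp add: octn_def cpx_def E nth_default_append nth_default_nth xs)
  have cpx_W: "cpx (W (16 * i) @ ys) (2 * t) = ocoords (omul (y i) (oconj (z i))) ! t" if "t < 4" for i t ys
    using that cpx_concat_Re_Im[of t "ocoords (omul (y i) (oconj (z i)))" ys]
    by (simp add: W_def rquad_product y_def z_def)
  have slot: "cpx E (slot 2 i l) = pcoords (y i) (z i) ! l" if "i < 2" "l < 12" for i l
  proof -
    have "cpx (W 0 @ W 16 @ [y 0 \<bullet> y 0, y 1 \<bullet> y 1]) (8 * i + 2 * t) = ocoords (omul (y i) (oconj (z i))) ! t"
      if "t < 4" for t
    proof (cases "i = 0")
      case True
      then show ?thesis using cpx_W[OF that, of 0] by simp
    next
      case False
      then have "i = 1" using \<open>i < 2\<close> by simp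
      then show ?thesis
        using cpx_W[OF that, of 1] cpx_append[of "W 0" "W 16 @ [y 0 \<bullet> y 0, y 1 \<bullet> y 1]" "2 * t"]
        by (simp add: len_W)
    qed
    then show ?thesis
      using cpx_slot[of xs 2 i l "W 0 @ W 16 @ [y 0 \<bullet> y 0, y 1 \<bullet> y 1]"] that xs
      by (simp add: E y_def z_def)
  qed
  have "nth_default 0 E 48 = y 0 \<bullet> y 0" "nth_default 0 E 49 = y 1 \<bullet> y 1"
    by (simp_all add: E nth_default_append nth_append xs len_W nth_default_Cons)
  then have yy: "2 * (y 0 \<bullet> y 0) * (y 1 \<bullet> y 1) = U"
    using eqs[of "(- U, [(2, 48, 49)])"] unfolding E_def[symmetric] by (simp add: two_orbits_eqs_def)
  have norms: "y 0 \<bullet> y 0 + z 0 \<bullet> z 0 = T" "y 1 \<bullet> y 1 + z 1 \<bullet> z 1 = T" "y 0 \<bullet> y 0 + y 1 \<bullet> y 1 = T"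
    using eqs[of "(- T, squares 0 16)"] eqs[of "(- T, squares 16 16)"] eqs[of "(- T, squares 0 8 @ squares 16 8)"]
    unfolding E_def[symmetric] squares_16 rquad_append rquad_squares
    by (simp_all add: two_orbits_eqs_def squares_16 octn_E y_def z_def)
  define u where "u = y 0 \<bullet> y 0"
  have yz: "y 0 \<bullet> y 0 = u" "z 0 \<bullet> z 0 = T - u" "y (Suc 0) \<bullet> y (Suc 0) = T - u" "z (Suc 0) \<bullet> z (Suc 0) = u"
    using norms by (simp_all add: u_def)
  have u: "2 * u * (T - u) = U" using yy by (simp add: yz)
  have T2: "real_of_int T * real_of_int T = 2 * real_of_int U + real_of_int K"
    using arg_cong[OF diag(2), of real_of_int] by (simp add: power2_eq_square)
  have D: "(real_of_int P)\<^sup>2 + u * (T - u) + (T - u) * u = \<alpha> * s\<^sup>2"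
    "(real_of_int P)\<^sup>2 + (T - u) * u + u * (T - u) = \<alpha> * s\<^sup>2"
    using diag(1) u by (simp_all add: algebra_simps)
  have "(T - u) * (T - u) = T * T - 2 * u * (T - u) - u * u"
    by (simp add: algebra_simps)
  then have D': "(real_of_int P)\<^sup>2 + u * u + (T - u) * (T - u) = \<alpha> * s\<^sup>2 + K"
    "(real_of_int P)\<^sup>2 + (T - u) * (T - u) + u * u = \<alpha> * s\<^sup>2 + K"
    using diag(1) u T2 by simp_all
  have self: "rquad E (re_quad 2 i i (int n) P ?w K r) = 0"
    if "i < 2" "2 \<le> r" "r \<le> int n div 2" for i r
    using eqs[of "re_quad 2 i i (int n) P ?w K r"] that less_2_cases[OF \<open>i < 2\<close>]
    by (auto simp: two_orbits_eqs_def E_def)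
  have cross: "rquad E (re_quad 2 0 1 (int n) P ?w 0 r) = 0" "rquad E (im_quad 2 0 1 (int n) P ?w r) = 0"
    if "1 \<le> r" "r \<le> int n div 2" for r
  proof -
    have "r \<in> {1..int n div 2}" using that by simp
    then have "re_quad 2 0 1 (int n) P ?w 0 r \<in> set ?eqs" "im_quad 2 0 1 (int n) P ?w r \<in> set ?eqs"
      unfolding two_orbits_eqs_def by (simp_all, blast+)
    then show "rquad E (re_quad 2 0 1 (int n) P ?w 0 r) = 0" "rquad E (im_quad 2 0 1 (int n) P ?w r) = 0"
      unfolding E_def by (simp_all only: eqs)
  qed
  have len_w: "length ?w = 12" by (simp add: weights_def)
  show ?thesis
  proof (rule tight_simplex_orbits[where m = 2 and n = n and f = 1 and s = s and P = P and K = K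
        and y = y and z = z and a = a and b = b and c = c and d = d])
    show "real_of_int P + y i \<bullet> y i + z i \<bullet> z i = s" if "i < 2" for i :: nat
      using less_2_cases[OF that] by (auto simp: yz s_def)
    show "(real_of_int P)\<^sup>2 + y i \<bullet> y i * (y j \<bullet> y j) + z i \<bullet> z i * (z j \<bullet> z j) =
        (real (2 * n + 1) - 3) / (3 * (real (2 * n + 1) - 1)) * s\<^sup>2 + of_bool (i = j) * real_of_int K"
      if "i < 2" "j < 2" for i j :: nat
      using less_2_cases[OF that(1)] less_2_cases[OF that(2)] D D' unfolding \<alpha>_def
      by (auto simp: yz)
    show "Re (resid_sum {..<12} n ((!) ?w) (\<lambda>l. cscale P l * (cnj (pcoords (y i) (z i) ! l) * pcoords (y i) (z i) ! l)) r) = K"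
      if "i < 2" "2 \<le> r" "r \<le> int n div 2" for i :: nat and r
      using resid_sum_cpx(1)[OF slot[OF that(1)] slot[OF that(1)] refl, where P = P and n = n and w = ?w and r = r and K = K] self[OF that] by simp
    show "resid_sum {..<12} n ((!) ?w) (\<lambda>l. cscale P l * (cnj (pcoords (y i) (z i) ! l) * pcoords (y j) (z j) ! l)) r = 0"
      if "i < 2" "j < 2" "i < j" "1 \<le> r" "r \<le> int n div 2" for i j :: nat and r
    proof -
      have ij: "i = 0" "j = 1" using that by auto
      show ?thesis
        using resid_sum_cpx(1)[OF slot[of 0] slot[of 1] refl, where P = P and n = n and w = ?w and r = r and K = 0]
          resid_sum_cpx(2)[OF slot[of 0] slot[of 1] refl, where P = P and n = n and w = ?w and r = r] cross[OF that(4,5)]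
        by (simp add: ij complex_eq_iff)
    qed
    show "pcoords (y i) (z i) ! l = 0" if "l < 12" "?w ! l mod int n = 0" for i l :: nat
      using that w len_w by (metis nth_mem)
    show "real_of_int P = (real (2 * n + 1) - 3) / (3 * (real (2 * n + 1) - 1)) * s"
      using fixed by (simp only: \<alpha>_def)
    show "real n * real_of_int K = (1 - (real (2 * n + 1) - 3) / (3 * (real (2 * n + 1) - 1))) * s\<^sup>2"
      using K by (simp only: \<alpha>_def of_int_mult of_int_of_nat_eq)
    show "0 < s" using pos by (simp add: s_def)
  qed (use n pos in auto)
qed

section \<open>The simplices\<close>

text \<open>The nonzero coordinates have residues 4, 2, 1, 3, 3 with squared norms 1/2, 1/2, 1, 1/2,
  1/2, so each pair of opposite residues carries 3/2.\<close>

lemma tight_simplex_5: "\<exists>Q. tight_simplex 5 Q"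
proof (rule tight_simplex_orbits[where m = 1 and n = 5 and f = 0 and s = 3 and P = 1 and K = "3 / 2"
      and y = "\<lambda>_. ((complex_of_real (sqrt (1 / 2)), complex_of_real (sqrt (1 / 2))), (0, 0))"
      and z = "\<lambda>_. ((1, 0), (0, 0))" and a = 1 and b = "- 1" and c = 0 and d = 3])
qed (auto simp: weights_def resid_sum_def sum_lessThan_12 pcoords_def ocoords_def omul_oconj_components
    cscale_def power2_eq_square inner_complex_def dest!: less_12_cases simp flip: of_real_mult)

text \<open>The weights are \<open>- 1\<close>, 1 and \<open>- 2\<close> with squared norms 2, 2 and
  4; both residue pairs carry 4, and \<open>P / s = 1 / 5\<close> is the inner product with the
  idempotent.\<close>

lemma tight_simplex_6: "\<exists>Q. tight_simplex 6 Q"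
proof (rule tight_simplex_orbits[where m = 1 and n = 5 and f = 1 and s = 5 and P = 1 and K = 4
      and y = "\<lambda>_. ((complex_of_real (sqrt 2), 0), (0, 0))"
      and z = "\<lambda>_. ((complex_of_real (sqrt 2), 0), (0, 0))" and a = 1 and b = 0 and c = 0 and d = "- 2"])
qed (auto simp: weights_def resid_sum_def sum_lessThan_12 pcoords_def ocoords_def omul_oconj_components
    cscale_def power2_eq_square inner_complex_def dest!: less_12_cases simp flip: of_real_mult)

text \<open>The exponents 0, 3, 1 of the vector entries form the difference set of the Fano plane:
  each pair of opposite residues occurs once.\<close>

lemma tight_simplex_7: "\<exists>Q. tight_simplex 7 Q"
proof (rule tight_simplex_orbits[where m = 1 and n = 7 and f = 0 and s = 3 and P = 1 and K = 1
      and y = "\<lambda>_. ((1, 0), (0, 0))" and z = "\<lambda>_. ((1, 0), (0, 0))"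
      and a = 1 and b = 0 and c = 0 and d = 2])
qed (auto simp: weights_def resid_sum_def sum_lessThan_12 pcoords_def ocoords_def omul_oconj_components
    cscale_def power2_eq_square inner_complex_def dest!: less_12_cases)

text \<open>In the certificates each coordinate is given by its value at a numerical solution and
  by a row of the rounded inverse Jacobian of the equations with respect to the coordinates that
  vary.  With \<open>s = P + 2 * T\<close> (or \<open>P + T\<close>) all coordinates are scaled by \<open>sqrt s\<close>.\<close>

lemma tight_simplex_8: "\<exists>Q. tight_simplex (8 + 0) Q"
proof (rule tight_simplex_one_orbit)
  \<comment> \<open>The choice \<open>P = T = (N - 1) * 10^8\<close>, used here and up to 21 points,
    makes all diagonal entries 1/3 and \<open>K = 6 * (N - 1) * 10^16\<close> an integer.\<close>
  show "certificate
    [(- 16224, [- 17, - 7, 4, 23, 17]), (0, []), (- 11695, [5, 10, - 6, - 32, 3]), (0, []),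
     (- 2768, []), (0, []), (- 17098, [0, 0, 0, 0, - 18]), (0, []),
     (14924, [10, 21, - 38, - 17, - 2]), (- 3294, []), (9460, []), (3703, []),
     (- 18299, [8, 5, - 31, - 14, - 2]), (- 2521, []), (- 2044, []), (4222, [])]
    (product_quadratics 0)
    (one_orbit_eqs (int 8) 700000000 700000000 420000000000000000 (weights 7 1 2 2))"
    by code_simp
qed (simp_all add: weights_def)

lemma tight_simplex_9: "\<exists>Q. tight_simplex (9 + 0) Q"
proof (rule tight_simplex_one_orbit)
  show "certificate
    [(12912, []), (0, []), (- 10928, [- 6, 12, - 19, - 29, 26]), (0, []),
     (9309, [19, 14, - 22, - 34, - 47]), (0, []), (- 20669, [0, 0, 0, 0, - 35]), (0, []),
     (11110, []), (- 13756, [6, - 11, 27, - 10, - 28]), (- 9738, []),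
     (- 16803, [- 5, - 5, - 22, 8, 23]), (10025, []), (- 1895, []), (- 2213, []), (1088, [])]
    (product_quadratics 0)
    (one_orbit_eqs (int 9) 800000000 800000000 480000000000000000 (weights 3 2 7 1))"
    by code_simp
qed (simp_all add: weights_def)

lemma tight_simplex_10: "\<exists>Q. tight_simplex (10 + 0) Q"
proof (rule tight_simplex_one_orbit)
  show "certificate
    [(14122, []), (0, []), (- 15216, [4, 15, - 47, - 34, - 29, - 5]), (0, []),
     (- 16237, [- 21, - 14, 44, 32, 27, 5]), (0, []), (14332, []), (0, []), (5209, []),
     (- 2423, []), (- 18957, [0, 0, 0, - 43, 0, 0]), (1486, []), (1869, [4, 4, 48, 26, 0, - 44]),
     (- 18245, [4, - 2, 10, 19, - 24, - 9]), (11511, [6, 20, 8, - 45, - 38, - 7]), (6045, [])]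
    (product_quadratics 0)
    (one_orbit_eqs (int 10) 900000000 900000000 540000000000000000 (weights 7 7 4 5))"
    by code_simp
qed (simp_all add: weights_def)

lemma tight_simplex_11: "\<exists>Q. tight_simplex (11 + 0) Q"
proof (rule tight_simplex_one_orbit)
  show "certificate
    [(- 9795, []), (0, []), (- 18875, [- 23, - 13, 34, 39, 20, 7]), (0, []),
     (- 16878, [0, 2, 9, - 28, - 17, 9]), (0, []), (- 16215, [8, 13, - 49, - 16, - 6, - 18]),
     (0, []), (9390, []), (19617, [0, 0, 0, 0, 0, 46]), (- 1390, []),
     (15550, [11, 23, - 16, - 11, - 33, - 49]), (- 9032, []), (- 6739, []), (- 5715, []),
     (- 11118, [15, 5, - 23, - 15, - 46, 12])]
    (product_quadratics 0)
    (one_orbit_eqs (int 11) 1000000000 1000000000 600000000000000000 (weights 5 1 5 9))"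
    by code_simp
qed (simp_all add: weights_def)

lemma tight_simplex_12: "\<exists>Q. tight_simplex (12 + 0) Q"
proof (rule tight_simplex_one_orbit)
  show "certificate
    [(17321, [0, 0, 0, 0, 0, 0, 29]), (0, []), (- 11883, [- 26, - 21, 37, 28, 55, 60, 21]),
     (0, []), (- 19362, [0, 0, 0, 0, 0, - 51, 0]), (0, []),
     (- 16849, [- 1, 15, - 26, - 20, - 39, 16, 15]), (0, []), (3331, []), (14629, []),
     (- 22626, [- 3, - 6, - 27, 3, 9, 13, 2]), (- 2861, []),
     (- 11164, [4, - 13, 31, 28, - 23, - 35, - 9]), (7579, []), (- 9950, []),
     (- 8583, [2, - 7, 30, - 44, 5, 11, 6])]
    (product_quadratics 0)
    (one_orbit_eqs (int 12) 1100000000 1100000000 660000000000000000 (weights 5 10 4 1))"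
    by code_simp
qed (simp_all add: weights_def)

lemma tight_simplex_13: "\<exists>Q. tight_simplex (13 + 0) Q"
proof (rule tight_simplex_one_orbit)
  show "certificate
    [(16231, [0, 0, 0, 0, 33, 0, 0]), (0, []), (10861, [18, 5, - 18, - 33, - 43, - 8, 4]),
     (0, []), (21955, [0, - 3, 9, 16, - 3, 4, - 2]), (0, []), (18346, []), (0, []), (11312, []),
     (- 14159, [- 10, - 13, - 4, 16, 23, 31, 23]), (9798, [- 17, - 12, 35, 18, 8, 46, 4]),
     (4687, []), (- 20385, [0, 0, 0, 0, 0, 0, - 26]), (13581, []),
     (- 11758, [- 2, - 10, 34, - 4, - 21, 1, 21]), (3918, [])]
    (product_quadratics 0)
    (one_orbit_eqs (int 13) 1200000000 1200000000 720000000000000000 (weights 12 2 6 10))"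
    by code_simp
qed (simp_all add: weights_def)

lemma tight_simplex_14: "\<exists>Q. tight_simplex (14 + 0) Q"
proof (rule tight_simplex_one_orbit)
  show "certificate
    [(17132, [7, - 5, - 23, 15, 30, - 23, 10, 3]), (0, []),
     (- 22326, [8, 9, - 50, - 23, - 3, - 11, - 20, - 7]), (0, []),
     (- 14102, [- 35, - 24, 40, 86, 40, 43, 29, 2]), (0, []),
     (- 17584, [3, 3, 9, - 25, 1, - 43, 12, 10]), (0, []), (10888, []),
     (- 13183, [12, 11, - 16, - 17, 4, - 13, - 70, - 2]), (- 2966, []),
     (- 17254, [7, - 5, - 23, 15, - 38, - 23, 10, 3]),
     (- 18893, [- 15, - 23, 32, - 2, 32, 30, 40, 30]), (- 6647, []),
     (17183, [0, 0, 0, 0, 0, 0, 0, 34]), (2181, [])]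
    (product_quadratics 0)
    (one_orbit_eqs (int 14) 1300000000 1300000000 780000000000000000 (weights 6 4 1 12))"
    by code_simp
qed (simp_all add: weights_def)

lemma tight_simplex_15: "\<exists>Q. tight_simplex (15 + 0) Q"
proof (rule tight_simplex_one_orbit)
  show "certificate
    [(- 17417, [- 6, 3, 14, - 7, - 17, - 10, 11, - 3]), (0, []),
     (24495, [0, 0, 26, 0, 0, 0, 0, 0]), (0, []), (- 15585, []), (0, []),
     (- 15930, [- 7, - 3, 24, 8, 18, 11, - 12, 4]), (0, []),
     (- 11155, [9, 6, - 14, - 2, - 41, 13, 1, - 44]),
     (- 15254, [- 6, - 5, 10, 1, - 11, - 10, - 1, 32]), (8230, []),
     (14171, [11, 16, - 23, - 31, - 40, - 25, - 14, - 13]), (17447, [0, 0, 0, 36, 0, 0, 0, 0]),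
     (- 17193, []), (3439, []), (- 12748, [12, 2, - 25, 15, 5, - 27, - 15, - 14])]
    (product_quadratics 0)
    (one_orbit_eqs (int 15) 1400000000 1400000000 840000000000000000 (weights 4 1 3 1))"
    by code_simp
qed (simp_all add: weights_def)

lemma tight_simplex_16: "\<exists>Q. tight_simplex (16 + 0) Q"
proof (rule tight_simplex_one_orbit)
  show "certificate
    [(18573, [11, 6, - 5, - 13, - 29, - 1, - 13, - 21, - 14]), (0, []),
     (- 15970, [- 1, 7, - 6, - 15, 9, - 1, - 16, - 25, 4]), (0, []),
     (- 17321, [0, 0, 0, 0, 0, 0, 0, 0, - 19]), (0, []),
     (- 24495, [0, 0, 0, 0, - 28, 0, 0, 0, 0]), (0, []),
     (- 20837, [9, 13, - 30, - 38, 0, - 35, - 18, - 6, - 3]),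
     (- 12877, [- 14, - 21, 49, 9, 0, 56, 29, 9, 5]),
     (17988, [- 1, 7, - 5, - 14, 8, - 1, - 14, 15, 4]), (4624, []),
     (- 14519, [- 2, - 5, 8, 18, 13, - 7, - 15, 12, 10]), (5655, []),
     (9493, [- 1, 4, 22, - 17, 5, - 10, 4, - 12, 8]), (14905, [])]
    (product_quadratics 0)
    (one_orbit_eqs (int 16) 1500000000 1500000000 900000000000000000 (weights 13 7 6 2))"
    by code_simp
qed (simp_all add: weights_def)

lemma tight_simplex_17: "\<exists>Q. tight_simplex (17 + 0) Q"
proof (rule tight_simplex_one_orbit)
  show "certificate
    [(16824, [18, 13, - 31, - 43, - 31, - 18, - 23, - 37, - 14]), (0, []),
     (24495, [0, 0, 0, 0, 0, 0, 0, 29, 0]), (0, []), (- 24495, [0, 0, 0, - 29, 0, 0, 0, 0, 0]),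
     (0, []), (- 10814, [6, 20, - 49, 0, - 48, - 28, - 36, 9, - 22]), (0, []), (- 335, []),
     (- 11184, [6, - 4, 17, - 14, 17, 18, - 28, - 12, - 9]),
     (- 18474, [0, 0, - 39, 0, 0, 0, 0, 0, 0]), (- 16085, []),
     (7912, [8, 8, - 49, - 19, - 27, 2, - 43, - 27, 34]),
     (- 18142, [3, 4, - 22, 0, - 11, - 27, - 23, 1, 7]),
     (20207, [3, 11, - 26, 0, 10, - 15, - 19, 5, - 12]), (8645, [])]
    (product_quadratics 0)
    (one_orbit_eqs (int 17) 1600000000 1600000000 960000000000000000 (weights 8 2 12 8))"
    by code_simp
qed (simp_all add: weights_def)

lemma tight_simplex_18: "\<exists>Q. tight_simplex (18 + 0) Q"
proof (rule tight_simplex_one_orbit)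
  show "certificate
    [(20000, [0, - 13, 0, 38, 38, 0, 38, 0, 0, 19]), (0, []),
     (- 16920, [2, 8, 13, - 12, 10, - 14, - 12, - 30, - 10, - 6]), (0, []),
     (20340, [- 11, - 6, 48, - 10, 8, 26, - 10, 13, 29, - 5]), (0, []),
     (- 24495, [- 21, - 21, 31, 31, 31, 31, 31, 31, 31, 16]), (0, []), (3110, []),
     (- 24297, [0, 0, 0, - 31, 0, 0, 0, 0, 0, 0]),
     (3192, [- 4, - 5, - 23, 25, 5, - 14, - 7, 14, 50, - 12]),
     (13777, [1, 20, 5, - 61, - 1, 3, - 54, - 3, - 12, - 25]),
     (16435, [- 1, - 6, - 13, 18, 4, 10, 12, - 4, 9, 25]),
     (- 5466, [- 2, - 17, - 38, 55, 11, 30, 35, - 11, 26, 4]),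
     (23811, [0, 0, 0, 0, 0, 0, 32, 0, 0, 0]), (5747, [])]
    (product_quadratics 0)
    (one_orbit_eqs (int 18) 1700000000 1700000000 1020000000000000000 (weights 3 14 9 11))"
    by code_simp
qed (simp_all add: weights_def)

lemma tight_simplex_19: "\<exists>Q. tight_simplex (19 + 0) Q"
proof (rule tight_simplex_one_orbit)
  show "certificate
    [(24495, [0, 0, 33, 0, 0, 0, 0, 0, 0, 0]), (0, []),
     (24495, [22, 22, - 33, - 33, - 33, - 33, - 33, - 33, - 33, - 33]), (0, []),
     (16389, [- 3, - 15, - 6, 34, 6, 12, 39, 6, 29, 26]), (0, []),
     (- 18204, [12, 16, - 5, - 14, - 39, - 34, - 9, - 39, - 18, - 21]), (0, []),
     (- 18193, [- 3, - 13, - 5, 30, 5, 11, - 9, 5, 26, 23]), (- 643, []),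
     (573, [- 8, - 11, 20, 25, - 15, 51, - 4, 24, 19, - 8]),
     (- 24488, [0, 0, 0, - 32, 0, 1, 0, 1, 0, 0]),
     (14416, [- 4, 2, - 6, - 18, 7, 14, - 11, 7, - 23, 29]), (- 7796, []),
     (18418, [0, - 2, - 2, 11, 19, 8, - 3, - 29, 33, 8]),
     (16149, [0, 2, 2, - 12, - 22, - 9, 4, 33, 12, - 9])]
    (product_quadratics 0)
    (one_orbit_eqs (int 19) 1800000000 1800000000 1080000000000000000 (weights 6 3 10 15))"
    by code_simp
qed (simp_all add: weights_def)

lemma tight_simplex_20: "\<exists>Q. tight_simplex (20 + 0) Q"
proof (rule tight_simplex_one_orbit)
  show "certificate
    [(- 24495, [0, 0, 0, 0, 0, - 7, 0, 0, 0, 0, 0]), (0, []),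
     (- 17321, [0, 0, 0, 0, 0, 0, 0, 0, 0, 0, - 5]), (0, []),
     (- 22361, [3, 3, - 8, - 8, 0, 0, - 8, 0, 0, - 8, 0]), (0, []),
     (22361, [5, 3, - 8, - 8, 0, - 8, - 8, 0, 0, - 8, - 4]), (0, []),
     (- 2823, [0, - 2, 1, 7, 3, - 5, - 6, 7, 6, 3, - 3]),
     (- 9593, [0, - 5, 0, - 2, 17, 1, 2, 16, 16, - 1, 1]), (2605, []),
     (24356, [0, 0, 0, 0, 7, 0, 0, 0, 0, 0, 0]),
     (- 22356, [3, 3, - 3, - 10, - 4, - 2, - 10, - 1, - 8, - 6, - 1]),
     (- 10011, [- 7, - 8, 6, 22, 9, 5, 22, 2, 0, 15, 2]),
     (24296, [1, 2, - 1, - 3, - 2, 0, - 3, 5, - 2, - 4, 0]),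
     (3114, [- 9, - 13, 6, 23, 15, 0, 25, 15, 14, 29, 1])]
    (product_quadratics 0)
    (one_orbit_eqs (int 20) 1900000000 1900000000 1140000000000000000 (weights 1 16 8 14))"
    by code_simp
qed (simp_all add: weights_def)

lemma tight_simplex_21: "\<exists>Q. tight_simplex (21 + 0) Q"
proof (rule tight_simplex_one_orbit)
  show "certificate
    [(20000, [- 15, - 15, 0, 45, 45, 0, 45, 0, 0, 45, 0]), (0, []), (24495, [24, 24, - 37, - 37,
     - 37, - 37, - 37, - 37, - 37, - 37, - 37]), (0, []),
     (- 24495, [0, 0, 0, 0, 0, 0, 0, 0, 0, 0, - 37]), (0, []),
     (- 20000, [0, 15, - 45, 0, 0, - 45, 0, - 45, - 45, 0, 0]), (0, []),
     (24493, [0, 0, 0, 0, 0, 0, 0, 0, 37, - 1, 0]),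
     (295, [- 2, - 13, - 41, 15, - 35, 18, 24, 15, 20, 59, - 19]),
     (4912, [- 13, 2, 2, - 9, 33, - 19, 62, - 39, - 31, 11, 29]),
     (- 23997, [- 3, 0, 0, - 2, 7, - 41, 13, - 8, - 6, 2, 6]),
     (20720, [- 9, - 9, - 16, 43, 0, 7, 39, 26, - 12, 23, - 5]),
     (13065, [14, 14, 26, - 69, 1, - 10, - 62, 28, 19, - 36, 8]), (- 1115, []),
     (14098, [0, 21, 0, 0, 0, - 64, 0, - 64, - 64, 0, 0])]
    (product_quadratics 0)
    (one_orbit_eqs (int 21) 2000000000 2000000000 1200000000000000000 (weights 13 16 7 4))"
    by code_simp
qed (simp_all add: weights_def)

text \<open>The idempotent forces \<open>P = 19 / 63 * s\<close>. In units of \<open>10^8\<close>,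
  \<open>s = 1323\<close>, \<open>P = 399\<close>, and \<open>T = 462\<close> is half of the
  remainder.\<close>

lemma tight_simplex_22: "\<exists>Q. tight_simplex (21 + 1) Q"
proof (rule tight_simplex_one_orbit)
  show "certificate
    [(120787, [0, 0, 0, 0, 0, 0, 18, 0, 0, 0, 0]), (0, []),
     (- 49311, [- 13, 0, 0, 44, 0, 0, 44, 0, 0, 44, 0]), (0, []),
     (120787, [0, 0, 0, 18, 0, 0, 0, 0, 0, 0, 0]), (0, []),
     (120787, [0, 0, 0, 0, 0, 0, 0, 0, 0, 18, 0]), (0, []), (13310, []),
     (120051, [0, 0, 18, 0, 0, 0, 0, 0, 0, 0, 0]),
     (- 108050, [- 2, - 7, 11, 2, 11, 1, 0, 12, 19, - 2, 4]),
     (- 53987, [4, 14, - 22, - 3, - 22, - 1, 0, - 25, - 38, 4, - 49]),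
     (- 27763, [- 3, - 13, 25, - 11, 17, 27, - 11, 13, 20, 3, 26]),
     (40753, [- 2, 8, - 37, - 8, 11, 18, - 7, 9, - 40, 2, - 36]),
     (- 120682, [0, 0, - 1, 0, - 1, 0, 1, 1, - 19, 0, - 1]),
     (5039, [- 3, 7, - 20, 8, - 19, 5, 16, 14, - 21, 7, - 28])]
    (product_quadratics 0)
    (one_orbit_eqs (int 21) 39900000000 46200000000 582120000000000000000 (weights 2 10 14 4))"
    by code_simp
qed (simp_all add: weights_def)

text \<open>The idempotent forces \<open>P = 10 / 33 * s\<close>. In units of \<open>10^10\<close>,
  \<open>s = 363\<close>, \<open>P = 110\<close> and \<open>T = s - P = 253\<close>; the diagonal
  condition then gives \<open>U = P * T\<close>.\<close>

lemma tight_simplex_23: "\<exists>Q. tight_simplex (2 * 11 + 1) Q"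
proof (rule tight_simplex_two_orbits)
  show "certificate
    [(- 850058, [0, 0, 0, 0, 0, - 141, 0, 0, 0, 0, 0, 0, 0, 0, 0, 0, 0, 0, 0, 0, 0, 0]), (0, []),
     (- 190790, []), (0, []), (869316, [0, 0, 1, - 1, - 1, - 1, 0, 137, 3, - 1, 1, 0, 1, 0, 2,
     - 1, 1, 0, 1, 0, 5, 18]), (0, []), (455141, [0, 1, 149, - 157, 2, - 261, 0, - 261, - 6, 3,
     - 2, 1, - 1, 0, - 3, 1, - 1, 0, - 2, 1, - 9, - 35]), (0, []), (19693, [- 5, 20, - 23, 28, 34,
     53, - 6, 25, - 135, 57, - 54, 37, - 32, 5, - 69, 23, - 34, - 7, - 49, 19, - 202, - 49]),
     (- 53865, [0, 0, 0, 0, 0, 0, 0, - 9, 1, 0, 0, 8, 0, 0, 0, 0, 0, 0, 0, 0, 1, 275]), (- 550050,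
     [- 32, 10, 55, - 72, 26, - 24, 9, 4, 100, - 88, - 112, - 80, 111, 167, - 64, - 29, - 92, 87,
     - 14, 38, 8, 83]), (- 321340, [- 89, - 18, - 7, 1, 173, 285, 133, 221, 17, 23, 83, 41, - 80,
     - 25, 72, 107, - 2, 2, 64, - 17, 54, - 221]), (- 397035, [92, - 8, - 26, 23, - 216, - 136,
     - 220, - 106, - 32, 38, 54, 53, - 77, - 28, 44, 84, 6, - 9, 22, - 8, - 18, 166]), (- 485371,
     [- 41, 2, 85, - 62, 17, - 58, 45, - 63, - 104, 62, 43, 40, - 16, - 168, - 19, - 93, 76, - 92,
     - 1, - 34, - 22, - 101]), (- 19075, [- 5, 3, - 74, 57, 112, 91, - 68, 171, 112, - 78, - 45,
     - 96, 58, 106, 47, - 43, 54, 32, - 104, 30, 76, 44]), (73802, [95, - 29, - 138, 169, - 80,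
     - 35, - 254, 42, 34, 22, 102, 100, - 20, - 95, - 24, 72, - 131, 13, 276, - 60, 129, 110]),
     (- 156432, [0, 0, 0, 0, 0, 24, 0, 0, 0, - 37, 0, 0, 0, 0, 0, 0, - 268, 9, 0, 0, 0, 0]),
     (- 109224, [0, 0, 0, 0, 0, 18, 0, 0, 0, 0, 0, 0, 0, 0, 0, 0, 0, - 282, 0, 0, 0, 0]), (696978,
     [0, 0, 0, 0, 0, 8, 0, 0, 0, 164, 0, 0, 0, 0, 0, 0, - 60, - 42, 0, 0, 0, 0]), (- 486642, []),
     (19962, [- 5, 20, - 23, 28, 34, 53, - 6, 22, - 135, 57, - 54, 40, - 32, 5, - 69, 23, - 34,
     - 7, - 49, 19, 74, - 51]), (53766, []), (- 92157, [1, 43, - 29, 90, - 35, - 80, 17, 8, - 42,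
     - 286, - 168, - 128, 10, 94, 93, - 125, 17, 123, 121, 15, - 37, 160]), (- 193271, [- 1, - 18,
     178, - 413, 20, 44, - 9, - 1, 6, 762, 75, 65, - 8, - 44, - 52, 62, - 12, - 59, - 63, - 5, 25,
     - 82]), (- 869305, [0, 0, - 1, 1, 1, 1, 0, 1, - 3, 1, - 1, - 137, - 1, 0, - 2, 1, - 1, 0,
     - 1, 0, 2, - 1]), (4343, []), (460789, [- 22, 41, 60, - 140, 41, 22, 45, 45, 160, - 33,
     - 182, - 225, - 61, 188, - 59, - 119, - 44, 155, - 38, 31, 110, 100]), (- 375313, [- 36,
     - 28, 112, - 227, 35, - 11, 99, 30, 183, 217, 18, - 46, - 56, 305, - 40, - 195, 82, 61, - 81,
     - 3, 77, 191]), (- 309917, [- 39, 19, 164, - 304, 17, 23, 126, - 88, - 36, 333, - 112, - 41,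
     32, 124, - 67, 30, - 36, - 94, - 337, - 158, - 105, - 31]), (- 152756, []), (- 672555, [23,
     - 20, - 144, 277, 0, 9, - 82, 54, 28, - 299, - 81, 68, - 24, - 99, 15, 13, - 58, 115, 176,
     95, 78, - 22]), (203112, [])]
    two_orbits_prog
    (two_orbits_eqs (int 11) 1100000000000 2530000000000 2783000000000000000000000 834900000000000000000000 (weights 5 10 7 9))"
    by code_simp
qed (simp_all add: weights_def)

theorem theorem5p2:
  fixes N :: nat
  assumes "5 \<le> N" and "N \<le> 23"
  shows "\<exists>P. tight_simplex N P"
proof -
  have "N \<in> {5, 6, 7, 8, 9, 10, 11, 12, 13, 14, 15, 16, 17, 18, 19, 20, 21, 22, 23}"
    using assms unfolding insert_iff empty_iff by presburger
  then show ?thesis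
    using tight_simplex_5 tight_simplex_6 tight_simplex_7 tight_simplex_8 tight_simplex_9
      tight_simplex_10 tight_simplex_11 tight_simplex_12 tight_simplex_13 tight_simplex_14
      tight_simplex_15 tight_simplex_16 tight_simplex_17 tight_simplex_18 tight_simplex_19
      tight_simplex_20 tight_simplex_21 tight_simplex_22 tight_simplex_23
    by auto
qed

end
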